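(* Consider the function \[\varphi(z) = \frac{\sqrt{6}}{\pi}\sum_{k=1}^\infty \frac{1}{k} \prod_{j=(k-1)k/2+1}^{k(k+1)/2} \frac{z_{2j-1}+z_{2j}}{\sqrt{2}}\] in $H^2(\mathbb{T}^\infty)$. It holds that $\|\mathbf{H}_\varphi\|=\|\varphi\|_{H^2(\mathbb{T}^\infty)}=1$, but for no $2<p\leq\infty$ is there an element $\psi$ in $L^p(\mathbb{T}^\infty)$ such that $P\psi = \varphi$.
   Context: $\mathbb{T}^\infty$ is the countably infinite product of the unit circle $\mathbb{T}$, with variables $z=(z_1,z_2,\ldots)$, equipped with its normalized Haar measure. Its characters are the monomials $z^\alpha$ indexed by finitely supported integer sequences $\alpha$. $H^2(\mathbb{T}^\infty)$ is the subspace of $L^2(\mathbb{T}^\infty)$ of functions whose Fourier coefficients are supported on the finitely supported sequences of nonnegative integers, and $\overline{H^2}(\mathbb{T}^\infty)$ is the subspace of complex conjugates of functions in $H^2(\mathbb{T}^\infty)$. Let $P$ and $\overline{P}$ be the orthogonal projections from $L^2(\mathbb{T}^\infty)$ to $H^2(\mathbb{T}^\infty)$ and to $\overline{H^2}(\mathbb{T}^\infty)$, respectively. For $\varphi$ in $H^2(\mathbb{T}^\infty)$ the (small) Hankel operator $\mathbf{H}_\varphi$ from $H^2(\mathbb{T}^\infty)$ to $\overline{H^2}(\mathbb{T}^\infty)$ is $\mathbf{H}_\varphi f = \overline{P}(\overline{\varphi} f)$; it is initially defined for (analytic) polynomials $f$ (in finitely many variables), and $\|\mathbf{H}_\varphi\|\in[0,\infty]$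 denotes the supremum of $\|\mathbf{H}_\varphi f\|_{L^2}$ over polynomials $f$ with $\|f\|_{H^2}=1$ (the operator extends to a bounded operator when this is finite). The series defining $\varphi$ converges in $H^2(\mathbb{T}^\infty)$. *)

theory Defs
  imports "HOL-Probability.Probability" "HOL-Probability.Essential_Supremum"
    "HOL-Library.Poly_Mapping"
begin

text \<open>Normalized Haar measure of the circle group, carried by the unit circle as a Borel space:
  the image of the uniform distribution of the angle.\<close>

definition circle_haar :: "complex measure" where
  "circle_haar =
     distr (uniform_measure lborel {0..<2 * pi}) (restrict_space borel (sphere 0 1)) cis"

text \<open>Normalized Haar measure of the infinite torus.  Coordinates are numbered from 0, so
  the variable usually called \<open>z\<^sub>n\<close> (with \<open>n \<ge> 1\<close>) is \<open>z (n - 1)\<close>.\<close>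

definition torus_haar :: "(nat \<Rightarrow> complex) measure" where
  "torus_haar = (\<Pi>\<^sub>M i\<in>UNIV. circle_haar)"

text \<open>Elements of the Lebesgue spaces below are represented by measurable functions, not by
  equivalence classes, so equality of elements is almost everywhere equality.\<close>

definition Lp :: "ennreal \<Rightarrow> ((nat \<Rightarrow> complex) \<Rightarrow> complex) set" where
  "Lp p = {f \<in> borel_measurable torus_haar.
     if p = \<infinity> then esssup torus_haar (\<lambda>z. ereal (norm (f z))) < \<infinity>
     else integrable torus_haar (\<lambda>z. norm (f z) powr enn2real p)}"

definition L2_inner ::
    "((nat \<Rightarrow> complex) \<Rightarrow> complex) \<Rightarrow> ((nat \<Rightarrow> complex) \<Rightarrow> complex) \<Rightarrow> complex" where
  "L2_inner f g = (LINT z|torus_haar. f z * cnj (g z))"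

definition L2_norm :: "((nat \<Rightarrow> complex) \<Rightarrow> complex) \<Rightarrow> real" where
  "L2_norm f = sqrt (LINT z|torus_haar. (norm (f z))\<^sup>2)"

definition character :: "(nat \<Rightarrow>\<^sub>0 int) \<Rightarrow> (nat \<Rightarrow> complex) \<Rightarrow> complex" where
  "character \<alpha> z = (\<Prod>i\<in>Poly_Mapping.keys \<alpha>. z i powi Poly_Mapping.lookup \<alpha> i)"

definition fourier_coeff :: "((nat \<Rightarrow> complex) \<Rightarrow> complex) \<Rightarrow> (nat \<Rightarrow>\<^sub>0 int) \<Rightarrow> complex" where
  "fourier_coeff f \<alpha> = L2_inner f (character \<alpha>)"

definition nonneg_exponent :: "(nat \<Rightarrow>\<^sub>0 int) \<Rightarrow> bool" where
  "nonneg_exponent \<alpha> \<longleftrightarrow> (\<forall>i. 0 \<le> Poly_Mapping.lookup \<alpha> i)"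

definition H2 :: "((nat \<Rightarrow> complex) \<Rightarrow> complex) set" where
  "H2 = {f \<in> Lp 2. \<forall>\<alpha>. fourier_coeff f \<alpha> \<noteq> 0 \<longrightarrow> nonneg_exponent \<alpha>}"

definition conj_H2 :: "((nat \<Rightarrow> complex) \<Rightarrow> complex) set" where
  "conj_H2 = (\<lambda>f z. cnj (f z)) ` H2"

definition analytic_polynomials :: "((nat \<Rightarrow> complex) \<Rightarrow> complex) set" where
  "analytic_polynomials = {f. \<exists>A c. finite A \<and> (\<forall>\<alpha>\<in>A. nonneg_exponent \<alpha>) \<and>
     f = (\<lambda>z. \<Sum>\<alpha>\<in>A. c \<alpha> * character \<alpha> z)}"

text \<open>A representative of the orthogonal projection of \<open>f \<in> Lp 2\<close> to the closed subspace \<open>V\<close>;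
  it is determined up to almost everywhere equality.\<close>

definition orth_proj ::
    "((nat \<Rightarrow> complex) \<Rightarrow> complex) set \<Rightarrow> ((nat \<Rightarrow> complex) \<Rightarrow> complex) \<Rightarrow>
     (nat \<Rightarrow> complex) \<Rightarrow> complex" where
  "orth_proj V f = (SOME g. g \<in> V \<and> (\<forall>h\<in>V. L2_inner (\<lambda>z. f z - g z) h = 0))"

definition hankel ::
    "((nat \<Rightarrow> complex) \<Rightarrow> complex) \<Rightarrow> ((nat \<Rightarrow> complex) \<Rightarrow> complex) \<Rightarrow>
     (nat \<Rightarrow> complex) \<Rightarrow> complex" where
  "hankel \<phi> f = orth_proj conj_H2 (\<lambda>z. cnj (\<phi> z) * f z)"

definition hankel_norm :: "((nat \<Rightarrow> complex) \<Rightarrow> complex) \<Rightarrow> ennreal" where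
  "hankel_norm \<phi> =
     (SUP f\<in>{f \<in> analytic_polynomials. L2_norm f = 1}. ennreal (L2_norm (hankel \<phi> f)))"

definition symbol_partial_sum :: "nat \<Rightarrow> (nat \<Rightarrow> complex) \<Rightarrow> complex" where
  "symbol_partial_sum n z = complex_of_real (sqrt 6 / pi) *
     (\<Sum>k=1..n. 1 / of_nat k *
       (\<Prod>j = (k - 1) * k div 2 + 1..k * (k + 1) div 2.
         (z (2 * j - 2) + z (2 * j - 1)) / complex_of_real (sqrt 2)))"

definition is_symbol :: "((nat \<Rightarrow> complex) \<Rightarrow> complex) \<Rightarrow> bool" where
  "is_symbol \<phi> \<longleftrightarrow> \<phi> \<in> H2 \<and>
     (\<lambda>n. L2_norm (\<lambda>z. \<phi> z - symbol_partial_sum n z)) \<longlonglongrightarrow> 0"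

end

theory Submission
  imports Defs "HOL-Real_Asymp.Real_Asymp"
begin

text \<open>For finite sets \<open>I\<close> of indices the products \<open>e\<^sub>I\<close> of the normalized sums of pairs of variables
  form an orthonormal family, and for \<open>f\<close>, \<open>g\<close> in \<open>H\<^sup>2\<close> the inner product of \<open>f g\<close> with \<open>e\<^sub>I\<close> is the
  sum over \<open>S \<subseteq> I\<close> of the products of the coefficients of \<open>f\<close> at \<open>e\<^sub>S\<close> and of \<open>g\<close> at \<open>e\<close> of
  \<open>I - S\<close>.  The symbol is a combination of the \<open>e\<close> of disjoint blocks with square summable
  coefficients, so the inequality of arithmetic and geometric means and Bessel's inequality bound
  its Hankel form on unit vectors by 1; testing on \<open>f = 1\<close> shows that this is sharp.

  If \<open>P \<psi>\<close> were the symbol for some \<open>\<psi>\<close> in \<open>L\<^sup>p\<close> with \<open>p > 2\<close>, then pairing \<open>\<psi>\<close> with the \<open>k\<close>-th block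
  product would give a multiple of \<open>1 / k\<close>; but the \<open>L\<^sup>q\<close> norms of the block products for the
  conjugate exponent \<open>q < 2\<close> decay exponentially in \<open>k\<close> by independence.\<close>

text \<open>Elements of the Lebesgue spaces are functions, so \<open>L2_norm\<close> is only a
  seminorm, and \<open>orth_proj\<close> is a Hilbert choice that says nothing until a projection is
  known to exist; completeness of L2 and the projection theorem are proved for this reason. The
  convolution over subsets of \<open>I\<close> closes up because a divisor of a square-free monomial
  is given by a subset of its variables and because \<open>f\<close> and \<open>g\<close> have only
  nonnegative exponents. In the bound of the Hankel form, distinct blocks share no nonempty subset,
  so for those terms weights of at most 1 suffice; the constant coefficients are common to all
  blocks, and for them the squares of the weights must sum to at most 1. By zeta(2) = pi^2/6 the sum
  is exactly 1, so the symbol has norm 1 as well. Block \<open>k\<close> has \<open>k\<close>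
  factors: a single factor has L2 norm 1 but nonconstant modulus, so its q-th moment for q < 2 is
  some rho < 1, and the block has moment rho^k, far below its weight, which is of order 1/k.\<close>

section \<open>Haar measure on the circle and on the infinite torus\<close>

lemma measurable_cis_sphere:
  "cis \<in> uniform_measure lborel {0..<2 * pi} \<rightarrow>\<^sub>M restrict_space borel (sphere 0 1)"
  by (intro measurable_restrict_space2)
    (auto simp: measurable_cong_sets[OF sets_uniform_measure refl]
      intro!: borel_measurable_continuous_onI continuous_intros)

lemma prob_space_circle_haar: "prob_space circle_haar"
  using measurable_cis_sphere unfolding circle_haar_def
  by (intro prob_space.prob_space_distr prob_space_uniform_measure) auto

lemma space_circle_haar: "space circle_haar = sphere 0 1"
  by (simp add: circle_haar_def space_restrict_space)

lemma sets_circle_haar: "sets circle_haar = sets (restrict_space borel (sphere 0 1))"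
  by (simp add: circle_haar_def)

interpretation circles: product_prob_space "\<lambda>_::nat. circle_haar" UNIV
  by (simp add: product_prob_space_def product_sigma_finite_def product_prob_space_axioms_def
      prob_space_circle_haar prob_space_imp_sigma_finite)

interpretation torus: prob_space torus_haar
  unfolding torus_haar_def by (rule prob_space_PiM) (rule prob_space_circle_haar)

lemma norm_torus [simp]: "z \<in> space torus_haar \<Longrightarrow> norm (z i) = 1"
  by (auto simp: torus_haar_def space_PiM space_circle_haar)

lemma id_measurable_circle_haar: "(\<lambda>x. x) \<in> borel_measurable circle_haar"
  unfolding measurable_cong_sets[OF sets_circle_haar refl]
  by (rule measurable_restrict_space1) simp

lemma measurable_torus_component [measurable]: "(\<lambda>z. z i) \<in> borel_measurable torus_haar"
  unfolding torus_haar_def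
  using measurable_compose[OF measurable_component_singleton[of i UNIV "\<lambda>_. circle_haar"]
    id_measurable_circle_haar] by simp

section \<open>The Hilbert space of square integrable functions\<close>

lemma L2_iff: "f \<in> Lp 2 \<longleftrightarrow>
    f \<in> borel_measurable torus_haar \<and> integrable torus_haar (\<lambda>z. (norm (f z))\<^sup>2)"
  by (simp add: Lp_def)

lemma L2_measurable [measurable_dest]: "f \<in> Lp 2 \<Longrightarrow> f \<in> borel_measurable torus_haar"
  by (simp add: L2_iff)

lemma L2_integrable_norm_sq: "f \<in> Lp 2 \<Longrightarrow> integrable torus_haar (\<lambda>z. (norm (f z))\<^sup>2)"
  by (simp add: L2_iff)

lemma L2_bounded:
  assumes "f \<in> borel_measurable torus_haar" "\<And>z. z \<in> space torus_haar \<Longrightarrow> norm (f z) \<le> B"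
  shows "f \<in> Lp 2"
proof -
  have "integrable torus_haar (\<lambda>z. (norm (f z))\<^sup>2)"
    by (rule torus.integrable_const_bound[where B = "B\<^sup>2"])
      (use assms in \<open>auto intro!: AE_I2 power_mono\<close>)
  then show ?thesis using assms by (simp add: L2_iff)
qed

lemma L2_const [simp]: "(\<lambda>_. c) \<in> Lp 2"
  by (rule L2_bounded[of _ "norm c"]) auto

lemma L2_add [intro]:
  assumes "f \<in> Lp 2" "g \<in> Lp 2"
  shows "(\<lambda>z. f z + g z) \<in> Lp 2"
proof -
  note [measurable] = assms[THEN L2_measurable]
  have "integrable torus_haar (\<lambda>z. 2 * (norm (f z))\<^sup>2 + 2 * (norm (g z))\<^sup>2)"
    using assms[THEN L2_integrable_norm_sq] by simp
  then have "integrable torus_haar (\<lambda>z. (norm (f z + g z))\<^sup>2)"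
  proof (rule Bochner_Integration.integrable_bound)
    have "(norm (a + b))\<^sup>2 \<le> 2 * (norm a)\<^sup>2 + 2 * (norm b)\<^sup>2" for a b :: complex
    proof -
      have "(norm (a + b))\<^sup>2 \<le> (norm a + norm b)\<^sup>2"
        by (intro power_mono norm_triangle_ineq) auto
      also have "\<dots> \<le> 2 * (norm a)\<^sup>2 + 2 * (norm b)\<^sup>2"
        using sum_squares_ge_zero[of "norm a - norm b" 0] by (simp add: power2_eq_square algebra_simps)
      finally show ?thesis .
    qed
    then show "AE z in torus_haar. norm ((norm (f z + g z))\<^sup>2)
        \<le> norm (2 * (norm (f z))\<^sup>2 + 2 * (norm (g z))\<^sup>2)"
      by simp
  qed measurable
  then show ?thesis by (simp add: L2_iff)
qed

lemma L2_cmult [intro]: "f \<in> Lp 2 \<Longrightarrow> (\<lambda>z. c * f z) \<in> Lp 2"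
  by (auto simp: L2_iff norm_mult power_mult_distrib)

lemma borel_measurable_cnj [measurable (raw)]:
  "f \<in> borel_measurable M \<Longrightarrow> (\<lambda>z. cnj (f z)) \<in> borel_measurable M"
  by (rule measurable_compose[of f M borel cnj])
    (auto intro!: borel_measurable_continuous_onI continuous_intros)

lemma L2_cnj [intro]: "f \<in> Lp 2 \<Longrightarrow> (\<lambda>z. cnj (f z)) \<in> Lp 2"
  using borel_measurable_cnj[of f torus_haar] by (simp add: L2_iff)

lemma L2_diff [intro]:
  assumes "f \<in> Lp 2" "g \<in> Lp 2"
  shows "(\<lambda>z. f z - g z) \<in> Lp 2"
  using L2_add[OF assms(1) L2_cmult[OF assms(2), of "-1"]] by simp

lemma L2_sum [intro]:
  "(\<And>i. i \<in> A \<Longrightarrow> f i \<in> Lp 2) \<Longrightarrow> (\<lambda>z. \<Sum>i\<in>A. f i z) \<in> Lp 2"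
  by (induction A rule: infinite_finite_induct) auto

lemma L2_mult_bounded:
  assumes "f \<in> Lp 2" "g \<in> borel_measurable torus_haar"
    "\<And>z. z \<in> space torus_haar \<Longrightarrow> norm (g z) \<le> B"
  shows "(\<lambda>z. f z * g z) \<in> Lp 2"
proof -
  note [measurable] = assms(2) L2_measurable[OF assms(1)]
  have "integrable torus_haar (\<lambda>z. B\<^sup>2 * (norm (f z))\<^sup>2)"
    using assms by (auto dest: L2_integrable_norm_sq)
  then have "integrable torus_haar (\<lambda>z. (norm (f z * g z))\<^sup>2)"
  proof (rule Bochner_Integration.integrable_bound)
    have "(norm (f z * g z))\<^sup>2 \<le> B\<^sup>2 * (norm (f z))\<^sup>2" if "z \<in> space torus_haar" for z
      using power_mono[OF assms(3)[OF that] norm_ge_zero, of 2]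
      by (simp add: norm_mult power_mult_distrib mult.commute[of "B\<^sup>2"] mult_left_mono)
    then show "AE z in torus_haar. norm ((norm (f z * g z))\<^sup>2) \<le> norm (B\<^sup>2 * (norm (f z))\<^sup>2)"
      by (intro AE_I2) simp
  qed measurable
  then show ?thesis by (simp add: L2_iff)
qed

lemma L2_integrable_mult:
  assumes "f \<in> Lp 2" "g \<in> Lp 2"
  shows "integrable torus_haar (\<lambda>z. f z * g z)"
proof -
  note [measurable] = assms[THEN L2_measurable]
  have "norm (a * b) \<le> norm ((norm a)\<^sup>2 + (norm b)\<^sup>2)" for a b :: complex
  proof -
    have "2 * (norm a * norm b) \<le> (norm a)\<^sup>2 + (norm b)\<^sup>2"
      using sum_squares_bound[of "norm a" "norm b"] by simp
    moreover have "0 \<le> norm a * norm b" by simp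
    ultimately have "norm a * norm b \<le> (norm a)\<^sup>2 + (norm b)\<^sup>2" by linarith
    then show ?thesis by (simp add: norm_mult)
  qed
  then show ?thesis
    by (intro Bochner_Integration.integrable_bound[OF Bochner_Integration.integrable_add[OF assms[THEN L2_integrable_norm_sq]]])
      auto
qed

lemma L2_integrable_inner: "f \<in> Lp 2 \<Longrightarrow> g \<in> Lp 2 \<Longrightarrow> integrable torus_haar (\<lambda>z. f z * cnj (g z))"
  by (intro L2_integrable_mult L2_cnj)

lemma L2_inner_add_left:
  "f \<in> Lp 2 \<Longrightarrow> g \<in> Lp 2 \<Longrightarrow> h \<in> Lp 2 \<Longrightarrow>
    L2_inner (\<lambda>z. f z + g z) h = L2_inner f h + L2_inner g h"
  by (simp add: L2_inner_def distrib_right L2_integrable_inner)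

lemma L2_inner_diff_left:
  "f \<in> Lp 2 \<Longrightarrow> g \<in> Lp 2 \<Longrightarrow> h \<in> Lp 2 \<Longrightarrow>
    L2_inner (\<lambda>z. f z - g z) h = L2_inner f h - L2_inner g h"
  by (simp add: L2_inner_def left_diff_distrib L2_integrable_inner)

lemma L2_inner_cmult_left: "L2_inner (\<lambda>z. c * f z) h = c * L2_inner f h"
  by (simp add: L2_inner_def mult.assoc)

lemma L2_inner_commute: "L2_inner g f = cnj (L2_inner f g)"
  by (simp add: L2_inner_def mult.commute flip: Bochner_Integration.integral_cnj)

lemma L2_inner_cmult_right: "L2_inner h (\<lambda>z. c * f z) = cnj c * L2_inner h f"
  by (subst (1 2) L2_inner_commute) (simp add: L2_inner_cmult_left)

lemma L2_inner_sum_left: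
  "(\<And>i. i \<in> A \<Longrightarrow> f i \<in> Lp 2) \<Longrightarrow> h \<in> Lp 2 \<Longrightarrow>
    L2_inner (\<lambda>z. \<Sum>i\<in>A. f i z) h = (\<Sum>i\<in>A. L2_inner (f i) h)"
  by (simp add: L2_inner_def sum_distrib_right L2_integrable_inner Bochner_Integration.integral_sum)

lemma L2_inner_sum_right:
  "(\<And>i. i \<in> A \<Longrightarrow> f i \<in> Lp 2) \<Longrightarrow> h \<in> Lp 2 \<Longrightarrow>
    L2_inner h (\<lambda>z. \<Sum>i\<in>A. f i z) = (\<Sum>i\<in>A. L2_inner h (f i))"
  by (subst (1 2) L2_inner_commute) (simp add: L2_inner_sum_left)

lemma L2_inner_cong:
  "(\<And>z. z \<in> space torus_haar \<Longrightarrow> f z = f' z) \<Longrightarrow> (\<And>z. z \<in> space torus_haar \<Longrightarrow> g z = g' z) \<Longrightarrow>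
    L2_inner f g = L2_inner f' g'"
  unfolding L2_inner_def by (rule Bochner_Integration.integral_cong) auto

lemma L2_norm_ge_0 [simp]: "0 \<le> L2_norm f"
  by (simp add: L2_norm_def)

lemma L2_norm_sq: "(L2_norm f)\<^sup>2 = (LINT z|torus_haar. (norm (f z))\<^sup>2)"
  by (simp add: L2_norm_def)

lemma L2_inner_self: "L2_inner f f = of_real ((L2_norm f)\<^sup>2)"
  by (simp add: L2_inner_def L2_norm_sq complex_norm_square[symmetric] flip: of_real_power)

lemma L2_norm_eqI: "L2_inner f f = L2_inner g g \<Longrightarrow> L2_norm f = L2_norm g"
  by (simp add: L2_inner_self del: of_real_power)

lemma L2_norm_minus_commute: "L2_norm (\<lambda>z. f z - g z) = L2_norm (\<lambda>z. g z - f z)"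
  by (simp add: L2_norm_def norm_minus_commute)

lemma L2_norm_cnj: "L2_norm (\<lambda>z. cnj (f z)) = L2_norm f"
  by (simp add: L2_norm_def)

lemma L2_norm_sq_add:
  assumes "f \<in> Lp 2" "g \<in> Lp 2"
  shows "(L2_norm (\<lambda>z. f z + g z))\<^sup>2 = (L2_norm f)\<^sup>2 + (L2_norm g)\<^sup>2 + 2 * Re (L2_inner f g)"
proof -
  have "L2_inner (\<lambda>z. f z + g z) (\<lambda>z. f z + g z) =
    L2_inner f f + L2_inner g f + (L2_inner f g + L2_inner g g)"
    using assms
    by (simp add: L2_inner_def algebra_simps L2_integrable_inner Bochner_Integration.integral_add)
  then have "Re (L2_inner (\<lambda>z. f z + g z) (\<lambda>z. f z + g z)) =
    Re (L2_inner f f) + Re (L2_inner g f) + (Re (L2_inner f g) + Re (L2_inner g g))"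
    by simp
  then show ?thesis
    unfolding L2_inner_self by (subst (asm) L2_inner_commute[of g f]) simp
qed

lemma L2_norm_sq_cmult: "(L2_norm (\<lambda>z. c * f z))\<^sup>2 = (norm c)\<^sup>2 * (L2_norm f)\<^sup>2"
  by (simp add: L2_norm_sq norm_mult power_mult_distrib)

lemma L2_norm_sq_diff:
  assumes "f \<in> Lp 2" "g \<in> Lp 2"
  shows "(L2_norm (\<lambda>z. f z - g z))\<^sup>2 = (L2_norm f)\<^sup>2 + (L2_norm g)\<^sup>2 - 2 * Re (L2_inner f g)"
  using L2_norm_sq_add[OF assms(1) L2_cmult[OF assms(2), of "-1"]]
    L2_norm_sq_cmult[of "-1" g] L2_inner_cmult_right[of f "-1" g] by simp

text \<open>This quadratic in the real parameter \<open>t\<close> serves twice: it yields the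
  Cauchy-Schwarz inequality, and it is the variation that shows that the residual of a closest point
  is orthogonal to the subspace.\<close>

lemma L2_norm_sq_diff_component:
  fixes t :: real
  assumes "f \<in> Lp 2" "g \<in> Lp 2"
  shows "(L2_norm (\<lambda>z. f z - (t * L2_inner f g) * g z))\<^sup>2 =
    (L2_norm f)\<^sup>2 - 2 * t * (norm (L2_inner f g))\<^sup>2 + t\<^sup>2 * (norm (L2_inner f g))\<^sup>2 * (L2_norm g)\<^sup>2"
proof -
  have "Re (L2_inner f (\<lambda>z. (t * L2_inner f g) * g z)) = t * (norm (L2_inner f g))\<^sup>2"
    unfolding L2_inner_cmult_right cmod_power2 by (simp add: algebra_simps power2_eq_square)
  then show ?thesis
    using L2_norm_sq_diff[OF assms(1) L2_cmult[OF assms(2), of "t * L2_inner f g"]]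
    by (simp add: L2_norm_sq_cmult norm_mult power_mult_distrib)
qed

lemma L2_Cauchy_Schwarz:
  assumes "f \<in> Lp 2" "g \<in> Lp 2"
  shows "norm (L2_inner f g) \<le> L2_norm f * L2_norm g"
proof -
  define c where "c = (norm (L2_inner f g))\<^sup>2"
  have *: "0 \<le> (L2_norm f)\<^sup>2 - 2 * t * c + t\<^sup>2 * c * (L2_norm g)\<^sup>2" for t :: real
    unfolding c_def L2_norm_sq_diff_component[OF assms, symmetric] by simp
  have "c \<le> (L2_norm f * L2_norm g)\<^sup>2"
  proof (cases "L2_norm g = 0")
    case True
    have "c = 0"
    proof (rule ccontr)
      assume "c \<noteq> 0"
      then show False
        \<comment> \<open>If \<open>L2_norm g = 0\<close>, the quadratic is affine in
          \<open>t\<close> with slope -2 c; this \<open>t\<close> makes it equal to -(L2_norm f)^2 -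
          2, which is negative.\<close>
        using *[of "((L2_norm f)\<^sup>2 + 1) / c"] True by simp (use sum_squares_ge_zero[of "L2_norm f" 0] in \<open>simp add: power2_eq_square\<close>)
    qed
    then show ?thesis by simp
  next
    case False
    show ?thesis
    proof -
      define b where "b = (L2_norm g)\<^sup>2"
      have "b > 0" using False by (simp add: b_def)
      \<comment> \<open>The choice t = 1 / b minimizes the quadratic.\<close>
      then have "c / b \<le> (L2_norm f)\<^sup>2"
        using *[of "1 / b"] unfolding b_def[symmetric] by (simp add: power2_eq_square)
      then show ?thesis using \<open>b > 0\<close> by (simp add: pos_divide_le_eq power_mult_distrib b_def)
    qed
  qed
  then show ?thesis
    unfolding c_def by (rule power2_le_imp_le) simp
qed

lemma L2_norm_triangle:
  assumes "f \<in> Lp 2" "g \<in> Lp 2"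
  shows "L2_norm (\<lambda>z. f z + g z) \<le> L2_norm f + L2_norm g"
proof (rule power2_le_imp_le)
  have "Re (L2_inner f g) \<le> L2_norm f * L2_norm g"
    using L2_Cauchy_Schwarz[OF assms] complex_Re_le_cmod order_trans by blast
  then show "(L2_norm (\<lambda>z. f z + g z))\<^sup>2 \<le> (L2_norm f + L2_norm g)\<^sup>2"
    by (simp add: L2_norm_sq_add[OF assms] power2_sum)
qed simp

lemma L2_norm_triangle_diff:
  assumes "f \<in> Lp 2" "g \<in> Lp 2" "h \<in> Lp 2"
  shows "L2_norm (\<lambda>z. f z - h z) \<le> L2_norm (\<lambda>z. f z - g z) + L2_norm (\<lambda>z. g z - h z)"
  using L2_norm_triangle[OF L2_diff[OF assms(1,2)] L2_diff[OF assms(2,3)]] by simp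

lemma L2_norm_const: "L2_norm (\<lambda>_. c) = norm c"
  by (simp add: L2_norm_def torus.prob_space)

lemma tendsto_L2_inner_left:
  assumes "\<And>n. F n \<in> Lp 2" "f \<in> Lp 2" "h \<in> Lp 2" "(\<lambda>n. L2_norm (\<lambda>z. f z - F n z)) \<longlonglongrightarrow> 0"
  shows "(\<lambda>n. L2_inner (F n) h) \<longlonglongrightarrow> L2_inner f h"
proof (rule metric_tendsto_imp_tendsto)
  show "(\<lambda>n. L2_norm (\<lambda>z. f z - F n z) * L2_norm h) \<longlonglongrightarrow> 0"
    using tendsto_mult_left_zero[OF assms(4)] by simp
  show "\<forall>\<^sub>F n in sequentially. dist (L2_inner (F n) h) (L2_inner f h)
      \<le> dist (L2_norm (\<lambda>z. f z - F n z) * L2_norm h) 0"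
    using L2_Cauchy_Schwarz[OF L2_diff[OF assms(2,1)] assms(3)]
    by (auto simp: dist_norm L2_inner_diff_left assms norm_minus_commute)
qed

text \<open>Cauchy-Schwarz against the constant 1, which has norm 1 because the total mass is
  1.\<close>

lemma integral_norm_le_L2_norm:
  assumes "f \<in> Lp 2"
  shows "integrable torus_haar f" "(LINT z|torus_haar. norm (f z)) \<le> L2_norm f"
proof -
  have 1: "(\<lambda>z. of_real (norm (f z)) :: complex) \<in> Lp 2"
    using assms by (auto simp: L2_iff)
  show "integrable torus_haar f"
    using L2_integrable_mult[OF assms L2_const[of 1]] by simp
  have "norm (L2_inner (\<lambda>z. of_real (norm (f z))) (\<lambda>_. 1)) \<le> L2_norm f"
    using L2_Cauchy_Schwarz[OF 1 L2_const[of 1]] L2_norm_const[of 1] by (simp add: L2_norm_def)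
  then show "(LINT z|torus_haar. norm (f z)) \<le> L2_norm f"
    by (simp add: L2_inner_def)
qed

section \<open>Completeness of L2 and orthogonal projections\<close>

text \<open>Riesz-Fischer: along a fast subsequence the increments have summable L1 norms, hence the
  subsequence converges almost everywhere, and Fatou's lemma turns the pointwise limit into a limit
  in L2.\<close>

theorem L2_complete:
  fixes F :: "nat \<Rightarrow> (nat \<Rightarrow> complex) \<Rightarrow> complex"
  assumes F: "\<And>n. F n \<in> Lp 2"
    and Cauchy: "\<And>e. e > 0 \<Longrightarrow> \<exists>N. \<forall>m\<ge>N. \<forall>n\<ge>N. L2_norm (\<lambda>z. F m z - F n z) < e"
  obtains f where "f \<in> Lp 2" "(\<lambda>n. L2_norm (\<lambda>z. f z - F n z)) \<longlonglongrightarrow> 0"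
proof -
  note [measurable] = L2_measurable[OF F]
  have "\<forall>k. \<exists>N. \<forall>m\<ge>N. \<forall>n\<ge>N. L2_norm (\<lambda>z. F m z - F n z) < (1/2)^k"
    using Cauchy by simp
  then obtain N where N: "L2_norm (\<lambda>z. F m z - F n z) < (1/2)^k" if "m \<ge> N k" "n \<ge> N k" for k m n
    by metis
  \<comment> \<open>Summing the thresholds gives \<open>r l\<close> at least \<open>N k\<close> for
    all \<open>k\<close> up to \<open>l\<close>, although \<open>N\<close> itself may fail to be
    monotone.\<close>
  define r where "r k = (\<Sum>i\<le>k. N i)" for k
  have r: "N k \<le> r l" if "k \<le> l" for k l
    unfolding r_def using that by (intro member_le_sum) auto
  define D where "D k z = norm (F (r (Suc k)) z - F (r k) z)" for k z
  have [measurable]: "D k \<in> borel_measurable torus_haar" for k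
    unfolding D_def by measurable
  have "(\<integral>\<^sup>+z. ennreal (D k z) \<partial>torus_haar) \<le> ennreal ((1/2)^k)" for k
  proof -
    have d: "(\<lambda>z. F (r (Suc k)) z - F (r k) z) \<in> Lp 2" using F by auto
    have "(\<integral>\<^sup>+z. ennreal (D k z) \<partial>torus_haar) = ennreal (LINT z|torus_haar. D k z)"
      unfolding D_def by (rule nn_integral_eq_integral) (use integral_norm_le_L2_norm(1)[OF d] in auto)
    also have "\<dots> \<le> ennreal ((1/2)^k)"
      unfolding D_def
      using integral_norm_le_L2_norm(2)[OF d] N[OF r r, of k "Suc k" k] by (intro ennreal_leI) simp
    finally show ?thesis .
  qed
  then have "(\<integral>\<^sup>+z. suminf (\<lambda>k. ennreal (D k z)) \<partial>torus_haar) \<le> suminf (\<lambda>k. ennreal ((1/2)^k))"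
    by (subst nn_integral_suminf) (auto intro!: suminf_le)
  also have "\<dots> = ennreal (suminf (\<lambda>k. (1/2)^k))"
    by (intro suminf_ennreal2 summable_geometric) auto
  finally have "(\<integral>\<^sup>+z. suminf (\<lambda>k. ennreal (D k z)) \<partial>torus_haar) \<noteq> \<infinity>"
    by (auto simp: top_unique)
  then have "AE z in torus_haar. suminf (\<lambda>k. ennreal (D k z)) \<noteq> \<infinity>"
    by (intro nn_integral_PInf_AE) auto
  then have conv: "AE z in torus_haar. convergent (\<lambda>k. F (r k) z)"
  proof eventually_elim
    case (elim z)
    then have "summable (\<lambda>k. D k z)"
      by (intro summable_suminf_not_top) (auto simp: D_def)
    then have "summable (\<lambda>k. F (r (Suc k)) z - F (r k) z)"
      unfolding D_def by (rule summable_norm_cancel)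
    then have "convergent (\<lambda>k. F (r k) z - F (r 0) z)"
      unfolding summable_iff_convergent sum_lessThan_telescope[of "\<lambda>k. F (r k) z"] .
    then show ?case
      by (simp add: convergent_diff_const_right_iff)
  qed
  \<comment> \<open>On the null set where the subsequence diverges, \<open>lim\<close> has an
    unspecified value; \<open>f\<close> is still measurable there.\<close>
  define f where "f z = lim (\<lambda>k. F (r k) z)" for z
  have [measurable]: "f \<in> borel_measurable torus_haar"
    unfolding f_def by measurable
  have dist: "(\<lambda>z. f z - F m z) \<in> Lp 2 \<and> L2_norm (\<lambda>z. f z - F m z) \<le> (1/2)^k" if "m \<ge> N k" for m k
  proof -
    have "(\<integral>\<^sup>+z. ennreal ((norm (f z - F m z))\<^sup>2) \<partial>torus_haar) =
      (\<integral>\<^sup>+z. liminf (\<lambda>l. ennreal ((norm (F (r l) z - F m z))\<^sup>2)) \<partial>torus_haar)"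
    proof (rule nn_integral_cong_AE, use conv in eventually_elim)
      case (elim z)
      then have "(\<lambda>l. F (r l) z) \<longlonglongrightarrow> f z" by (simp add: f_def convergent_LIMSEQ_iff)
      then have "(\<lambda>l. ennreal ((norm (F (r l) z - F m z))\<^sup>2)) \<longlonglongrightarrow> ennreal ((norm (f z - F m z))\<^sup>2)"
        by (intro tendsto_intros)
      from lim_imp_Liminf[OF _ this] show ?case by simp
    qed
    \<comment> \<open>Fatou's lemma, with \<open>m\<close> fixed and the subsequence index
      \<open>l\<close> tending to infinity.\<close>
    also have "\<dots> \<le> liminf (\<lambda>l. \<integral>\<^sup>+z. ennreal ((norm (F (r l) z - F m z))\<^sup>2) \<partial>torus_haar)"
      by (rule nn_integral_liminf) measurable
    also have "\<dots> \<le> ennreal (((1/2)^k)\<^sup>2)"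
    proof (rule Liminf_le)
      show "\<forall>\<^sub>F l in sequentially. (\<integral>\<^sup>+z. ennreal ((norm (F (r l) z - F m z))\<^sup>2) \<partial>torus_haar)
          \<le> ennreal (((1/2)^k)\<^sup>2)"
      proof (rule eventually_sequentiallyI[of k])
        fix l assume "l \<ge> k"
        have "(\<integral>\<^sup>+z. ennreal ((norm (F (r l) z - F m z))\<^sup>2) \<partial>torus_haar) =
            ennreal ((L2_norm (\<lambda>z. F (r l) z - F m z))\<^sup>2)"
          unfolding L2_norm_sq by (rule nn_integral_eq_integral)
            (use L2_integrable_norm_sq[OF L2_diff[OF F F]] in auto)
        also have "\<dots> \<le> ennreal (((1/2)^k)\<^sup>2)"
          using N[OF r[OF \<open>l \<ge> k\<close>] that] by (intro ennreal_leI power_mono) auto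
        finally show "(\<integral>\<^sup>+z. ennreal ((norm (F (r l) z - F m z))\<^sup>2) \<partial>torus_haar)
          \<le> ennreal (((1/2)^k)\<^sup>2)" .
      qed
    qed simp
    finally have le: "(\<integral>\<^sup>+z. ennreal ((norm (f z - F m z))\<^sup>2) \<partial>torus_haar) \<le> ennreal (((1/2)^k)\<^sup>2)" .
    then have int: "integrable torus_haar (\<lambda>z. (norm (f z - F m z))\<^sup>2)"
      by (intro integrableI_nonneg) (auto simp: top_unique less_top[symmetric])
    then have "(L2_norm (\<lambda>z. f z - F m z))\<^sup>2 \<le> ((1/2)^k)\<^sup>2"
      using le unfolding L2_norm_sq by (subst (asm) nn_integral_eq_integral) auto
    then have "L2_norm (\<lambda>z. f z - F m z) \<le> (1/2)^k"
      by (rule power2_le_imp_le) simp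
    with int show ?thesis by (simp add: L2_iff)
  qed
  show ?thesis
  proof
    show "f \<in> Lp 2"
      using L2_add[OF conjunct1[OF dist[OF order_refl, of 0]] F[of "N 0"]] by simp
    show "(\<lambda>n. L2_norm (\<lambda>z. f z - F n z)) \<longlonglongrightarrow> 0"
    proof (rule LIMSEQ_I)
      fix e :: real assume "e > 0"
      then obtain k where "(1/2)^k < e" using real_arch_pow_inv[of e "1/2"] by auto
      then show "\<exists>n0. \<forall>n\<ge>n0. norm (L2_norm (\<lambda>z. f z - F n z) - 0) < e"
        using dist[of k] by (intro exI[of _ "N k"]) (auto intro: le_less_trans)
    qed
  qed
qed

text \<open>Applied to constant sequences, the closure clause also makes \<open>V\<close> stable
  under changing an L2 function on a null set, so such a \<open>V\<close> is a union of equivalence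
  classes.\<close>

definition L2_closed_subspace :: "((nat \<Rightarrow> complex) \<Rightarrow> complex) set \<Rightarrow> bool" where
  "L2_closed_subspace V \<longleftrightarrow> V \<subseteq> Lp 2 \<and> (\<lambda>_. 0) \<in> V \<and>
    (\<forall>f\<in>V. \<forall>g\<in>V. (\<lambda>z. f z + g z) \<in> V) \<and> (\<forall>f\<in>V. \<forall>c. (\<lambda>z. c * f z) \<in> V) \<and>
    (\<forall>F f. (\<forall>n. F n \<in> V) \<longrightarrow> f \<in> Lp 2 \<longrightarrow> (\<lambda>n. L2_norm (\<lambda>z. f z - F n z)) \<longlonglongrightarrow> 0 \<longrightarrow> f \<in> V)"

text \<open>A minimizing sequence for the distance from \<open>f\<close> to \<open>V\<close> is Cauchy by the parallelogram law.\<close>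

lemma L2_closest_point:
  assumes V: "L2_closed_subspace V" and f: "f \<in> Lp 2"
  obtains g where "g \<in> V" "\<forall>h\<in>V. L2_norm (\<lambda>z. f z - g z) \<le> L2_norm (\<lambda>z. f z - h z)"
proof -
  have VL: "h \<in> Lp 2" if "h \<in> V" for h using V that by (auto simp: L2_closed_subspace_def)
  define S where "S = (\<lambda>h. (L2_norm (\<lambda>z. f z - h z))\<^sup>2) ` V"
  define d where "d = Inf S"
  have S: "S \<noteq> {}" "bdd_below S"
    using V by (auto simp: S_def L2_closed_subspace_def intro!: bdd_belowI[of _ 0])
  have d: "d \<le> (L2_norm (\<lambda>z. f z - h z))\<^sup>2" if "h \<in> V" for h
    unfolding d_def using S that by (intro cInf_lower) (auto simp: S_def)
  have "\<exists>h\<in>V. (L2_norm (\<lambda>z. f z - h z))\<^sup>2 < d + 1 / real (Suc n)" for n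
    using cInf_lessD[OF S(1), of "d + 1 / real (Suc n)"] by (auto simp: d_def S_def)
  then obtain F where F: "\<And>n. F n \<in> V"
    and Fd: "\<And>n. (L2_norm (\<lambda>z. f z - F n z))\<^sup>2 < d + 1 / real (Suc n)"
    by metis
  have par: "(L2_norm (\<lambda>z. F m z - F n z))\<^sup>2 \<le> 2 / real (Suc m) + 2 / real (Suc n)" for m n
  proof -
    let ?a = "\<lambda>z. f z - F n z" and ?b = "\<lambda>z. f z - F m z"
    have ab: "?a \<in> Lp 2" "?b \<in> Lp 2" using f F VL by auto
    \<comment> \<open>The midpoint of \<open>F m\<close> and \<open>F n\<close> lies in
      \<open>V\<close>, so its squared distance to \<open>f\<close> is at least \<open>d\<close>;
      this bounds one side term of the parallelogram law from below.\<close>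
    have "(\<lambda>z. (1/2) * (F n z + F m z)) \<in> V"
      using V F[of n] F[of m] unfolding L2_closed_subspace_def by metis
    from d[OF this] have "4 * d \<le> 4 * (L2_norm (\<lambda>z. (1/2) * (?a z + ?b z)))\<^sup>2"
      by (simp add: field_simps)
    also have "\<dots> = (L2_norm (\<lambda>z. ?a z + ?b z))\<^sup>2"
      unfolding L2_norm_sq_cmult by (simp add: power2_eq_square)
    finally have "4 * d + (L2_norm (\<lambda>z. F m z - F n z))\<^sup>2
        \<le> 2 * (L2_norm ?a)\<^sup>2 + 2 * (L2_norm ?b)\<^sup>2"
      using L2_norm_sq_add[OF ab] L2_norm_sq_diff[OF ab] by simp
    then show ?thesis using Fd[of n] Fd[of m] by simp
  qed
  have "\<exists>N. \<forall>m\<ge>N. \<forall>n\<ge>N. L2_norm (\<lambda>z. F m z - F n z) < e" if "e > 0" for e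
  proof -
    obtain N where N: "4 / e\<^sup>2 < real (Suc N)" using reals_Archimedean2 by (metis less_Suc_eq of_nat_less_iff order_less_trans)
    have "L2_norm (\<lambda>z. F m z - F n z) < e" if "m \<ge> N" "n \<ge> N" for m n
    proof (rule power2_less_imp_less)
      have "(L2_norm (\<lambda>z. F m z - F n z))\<^sup>2 \<le> 2 / real (Suc m) + 2 / real (Suc n)" by (rule par)
      also have "\<dots> \<le> 2 / real (Suc N) + 2 / real (Suc N)"
        using that by (intro add_mono divide_left_mono) auto
      also have "\<dots> = 4 / real (Suc N)" by simp
      also have "\<dots> < e\<^sup>2"
        using N \<open>e > 0\<close> by (simp add: pos_divide_less_eq mult.commute del: of_nat_Suc)
      finally show "(L2_norm (\<lambda>z. F m z - F n z))\<^sup>2 < e\<^sup>2" .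
    qed (use \<open>e > 0\<close> in simp)
    then show ?thesis by blast
  qed
  then obtain g where g: "g \<in> Lp 2" "(\<lambda>n. L2_norm (\<lambda>z. g z - F n z)) \<longlonglongrightarrow> 0"
    using L2_complete[of F] VL[OF F] by metis
  have gV: "g \<in> V" using V F g unfolding L2_closed_subspace_def by blast
  show ?thesis
  proof (rule that[OF gV], rule ballI)
    fix h assume h: "h \<in> V"
    have "(\<lambda>n. L2_norm (\<lambda>z. g z - F n z) + sqrt (d + 1 / real (Suc n))) \<longlonglongrightarrow> 0 + sqrt (d + 0)"
      by (intro tendsto_add g tendsto_real_sqrt tendsto_const LIMSEQ_Suc[OF lim_1_over_n])
    moreover have "L2_norm (\<lambda>z. f z - g z) \<le> L2_norm (\<lambda>z. g z - F n z) + sqrt (d + 1 / real (Suc n))" for n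
    proof -
      have "L2_norm (\<lambda>z. f z - F n z) \<le> sqrt (d + 1 / real (Suc n))"
        using Fd[of n] by (intro real_le_rsqrt) simp
      then show ?thesis
        using L2_norm_triangle_diff[OF f VL[OF F[of n]] g(1)] L2_norm_minus_commute[of g "F n"] by simp
    qed
    ultimately have "L2_norm (\<lambda>z. f z - g z) \<le> sqrt d"
      by (intro LIMSEQ_le_const[where X = "\<lambda>n. L2_norm (\<lambda>z. g z - F n z) + sqrt (d + 1 / real (Suc n))"]) auto
    also have "\<dots> \<le> L2_norm (\<lambda>z. f z - h z)"
      using d[OF h] by (intro real_le_lsqrt) auto
    finally show "L2_norm (\<lambda>z. f z - g z) \<le> L2_norm (\<lambda>z. f z - h z)" .
  qed
qed

text \<open>Moving the closest point \<open>g\<close> by a small multiple of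
  \<open>L2_inner r h\<close> times \<open>h\<close>, with \<open>r\<close> the residual, would
  shorten the distance unless that inner product is 0. Once one function with the two properties
  exists, the choice in \<open>orth_proj\<close> has them too.\<close>

lemma
  assumes V: "L2_closed_subspace V" and f: "f \<in> Lp 2"
  shows orth_proj_mem: "orth_proj V f \<in> V"
    and orth_proj_orthogonal: "\<And>h. h \<in> V \<Longrightarrow> L2_inner (\<lambda>z. f z - orth_proj V f z) h = 0"
proof -
  obtain g where g: "g \<in> V" "\<forall>h\<in>V. L2_norm (\<lambda>z. f z - g z) \<le> L2_norm (\<lambda>z. f z - h z)"
    by (rule L2_closest_point[OF V f])
  have VL: "h \<in> Lp 2" if "h \<in> V" for h using V that by (auto simp: L2_closed_subspace_def)
  let ?r = "\<lambda>z. f z - g z"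
  have "L2_inner ?r h = 0" if h: "h \<in> V" for h
  proof -
    let ?c = "L2_inner ?r h"
    have le: "0 \<le> (t * (L2_norm h)\<^sup>2 - 2) * (norm ?c)\<^sup>2" if "t > 0" for t :: real
    proof -
      have "(\<lambda>z. (t * ?c) * h z) \<in> V"
        using V h unfolding L2_closed_subspace_def by simp
      then have "(\<lambda>z. g z + (t * ?c) * h z) \<in> V"
        using V g(1) unfolding L2_closed_subspace_def by simp
      then have "L2_norm ?r \<le> L2_norm (\<lambda>z. f z - (g z + (t * ?c) * h z))"
        by (rule bspec[OF g(2)])
      also have "(\<lambda>z. f z - (g z + (t * ?c) * h z)) = (\<lambda>z. ?r z - (t * ?c) * h z)"
        by (simp add: diff_diff_eq)
      finally have "(L2_norm ?r)\<^sup>2 \<le> (L2_norm (\<lambda>z. ?r z - (t * ?c) * h z))\<^sup>2"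
        by (intro power_mono) simp_all
      also have "\<dots> = (L2_norm ?r)\<^sup>2 - 2 * t * (norm ?c)\<^sup>2 + t\<^sup>2 * (norm ?c)\<^sup>2 * (L2_norm h)\<^sup>2"
        by (rule L2_norm_sq_diff_component) (use f VL g(1) h in auto)
      finally have "0 \<le> t * ((t * (L2_norm h)\<^sup>2 - 2) * (norm ?c)\<^sup>2)"
        by (simp add: algebra_simps power2_eq_square)
      then show ?thesis using that by (simp only: zero_le_mult_iff) auto
    qed
    \<comment> \<open>This value of \<open>t\<close> is positive and makes
      \<open>t * (L2_norm h)^2\<close> at most 1, also when \<open>L2_norm h = 0\<close>.\<close>
    have "1 / (1 + (L2_norm h)\<^sup>2) > 0" by (simp add: add_pos_nonneg)
    moreover have "1 / (1 + (L2_norm h)\<^sup>2) * (L2_norm h)\<^sup>2 - 2 < 0"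
    proof -
      have "(1 + (L2_norm h)\<^sup>2) > 0" by (simp add: add_pos_nonneg)
      then have "1 / (1 + (L2_norm h)\<^sup>2) * (L2_norm h)\<^sup>2 \<le> 1" by simp
      then show ?thesis by linarith
    qed
    ultimately have "(norm ?c)\<^sup>2 \<le> 0"
      using le[of "1 / (1 + (L2_norm h)\<^sup>2)"] by (simp only: zero_le_mult_iff) auto
    then show ?thesis by simp
  qed
  then have "\<exists>g. g \<in> V \<and> (\<forall>h\<in>V. L2_inner (\<lambda>z. f z - g z) h = 0)"
    using g(1) by blast
  then have "orth_proj V f \<in> V \<and> (\<forall>h\<in>V. L2_inner (\<lambda>z. f z - orth_proj V f z) h = 0)"
    unfolding orth_proj_def by (rule someI_ex)
  then show "orth_proj V f \<in> V" "\<And>h. h \<in> V \<Longrightarrow> L2_inner (\<lambda>z. f z - orth_proj V f z) h = 0"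
    by simp_all
qed

section \<open>Characters\<close>

text \<open>In the angle, the power becomes \<open>cis (n * x)\<close>, whose antiderivative for
  nonzero \<open>n\<close> is periodic with period \<open>2 * pi\<close>.\<close>

lemma integral_circle_haar_power_int:
  "(LINT z|circle_haar. z powi n) = (if n = 0 then 1 else 0)"
proof (cases "n = 0")
  case True
  then show ?thesis
    by (simp add: prob_space.prob_space[OF prob_space_circle_haar])
next
  case False
  have "(\<lambda>z::complex. z powi n) \<in> borel_measurable borel"
    unfolding power_int_def by measurable
  then have pow: "(\<lambda>z::complex. z powi n) \<in> borel_measurable (restrict_space borel (sphere 0 1))"
    by (rule measurable_restrict_space1)
  have unif: "uniform_measure lborel {0..<2 * pi} =
      density lborel (\<lambda>x. ennreal (indicator {0..<2 * pi} x / (2 * pi)))"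
    unfolding uniform_measure_def
    by (intro density_cong) (auto simp: indicator_def divide_ennreal ennreal_1[symmetric] simp del: ennreal_1)
  have meas: "(\<lambda>x. cis x powi n) \<in> borel_measurable lborel"
    unfolding cis_power_int
    by (auto intro!: borel_measurable_continuous_onI continuous_intros)
  have "(LINT z|circle_haar. z powi n) = (LINT x|uniform_measure lborel {0..<2 * pi}. cis x powi n)"
    unfolding circle_haar_def by (rule integral_distr[OF measurable_cis_sphere pow])
  also have "\<dots> = (LBINT x. (indicator {0..<2 * pi} x / (2 * pi)) *\<^sub>R cis x powi n)"
    unfolding unif by (rule integral_density[OF meas]) auto
  also have "\<dots> = (LBINT x. indicator {0..<2 * pi} x *\<^sub>R (cis (of_int n * x) /\<^sub>R (2 * pi)))"
    by (simp only: cis_power_int divide_inverse scaleR_scaleR)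
  also have "\<dots> = (LBINT x=ereal 0..ereal (2 * pi). cis (of_int n * x) /\<^sub>R (2 * pi))"
    by (subst interval_integral_Ico) (simp_all only: set_lebesgue_integral_def, simp)
  also have "\<dots> = cis (of_int n * (2 * pi)) / (\<i> * n) /\<^sub>R (2 * pi) - cis (of_int n * 0) / (\<i> * n) /\<^sub>R (2 * pi)"
  proof (rule interval_integral_FTC_finite)
    fix x :: real
    show "((\<lambda>x. cis (of_int n * x) / (\<i> * n) /\<^sub>R (2 * pi)) has_vector_derivative cis (of_int n * x) /\<^sub>R (2 * pi))
        (at x within {min 0 (2 * pi)..max 0 (2 * pi)})"
      unfolding cis_conv_exp using False
      by (auto intro!: derivative_eq_intros has_vector_derivative_real_field simp: field_simps scaleR_conv_of_real)
  qed (intro continuous_intros)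
  also have "\<dots> = 0"
    using cis_multiple_2pi[of "of_int n"] by (simp add: mult_ac)
  finally show ?thesis using False by simp
qed

text \<open>Independence means that the joint law is the product of the marginals; here the joint
  law is that of the identity map, which is the product measure itself.\<close>

lemma indep_torus_components: "torus.indep_vars (\<lambda>_. circle_haar) (\<lambda>i z. z i) UNIV"
proof -
  have "distr torus_haar torus_haar (\<lambda>z. z) = torus_haar"
    by (rule distr_id)
  then have "distr torus_haar (\<Pi>\<^sub>M i\<in>UNIV. circle_haar) (\<lambda>z. \<lambda>i\<in>UNIV. z i) =
      (\<Pi>\<^sub>M i\<in>UNIV. distr torus_haar circle_haar (\<lambda>z. z i))"
    by (simp add: torus_haar_def circles.PiM_component restrict_UNIV)
  then show ?thesis
    by (subst torus.indep_vars_iff_distr_eq_PiM) (auto simp: torus_haar_def)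
qed

lemma character_superset:
  assumes "finite A" "Poly_Mapping.keys \<alpha> \<subseteq> A"
  shows "character \<alpha> z = (\<Prod>i\<in>A. z i powi Poly_Mapping.lookup \<alpha> i)"
  unfolding character_def using assms
  by (intro prod.mono_neutral_left) (auto simp: in_keys_iff)

lemma torus_nonzero: "z \<in> space torus_haar \<Longrightarrow> z i \<noteq> 0"
  using norm_torus[of z i] by force

lemma character_add:
  assumes "z \<in> space torus_haar"
  shows "character (\<alpha> + \<beta>) z = character \<alpha> z * character \<beta> z"
proof -
  let ?A = "Poly_Mapping.keys \<alpha> \<union> Poly_Mapping.keys \<beta>"
  have "Poly_Mapping.keys (\<alpha> + \<beta>) \<subseteq> ?A" by (rule keys_add)
  then show ?thesis
    using torus_nonzero[OF assms]
    by (simp add: character_superset[of ?A] lookup_add power_int_add flip: prod.distrib)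
qed

lemma character_0 [simp]: "character 0 z = 1"
  by (simp add: character_def)

lemma norm_character [simp]: "z \<in> space torus_haar \<Longrightarrow> norm (character \<alpha> z) = 1"
  by (simp add: character_def norm_power_int flip: prod_norm)

lemma character_uminus:
  assumes "z \<in> space torus_haar"
  shows "character (- \<alpha>) z = cnj (character \<alpha> z)"
proof -
  have "character \<alpha> z * character (- \<alpha>) z = 1"
    using character_add[OF assms, of \<alpha> "- \<alpha>"] by simp
  moreover have "character \<alpha> z * cnj (character \<alpha> z) = 1"
    using norm_character[OF assms, of \<alpha>] by (simp add: complex_norm_square[symmetric])
  ultimately show ?thesis
    by (metis mult_cancel_left mult_zero_left zero_neq_one)
qed

lemma character_diff:
  "z \<in> space torus_haar \<Longrightarrow> character (\<alpha> - \<beta>) z = character \<alpha> z * cnj (character \<beta> z)"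
  using character_add[of z \<alpha> "- \<beta>"] by (simp add: character_uminus)

lemma measurable_character [measurable]: "character \<alpha> \<in> borel_measurable torus_haar"
proof -
  have "(\<lambda>z::complex. z powi n) \<in> borel_measurable borel" for n
    unfolding power_int_def by measurable
  then have "(\<lambda>z. z i powi n) \<in> borel_measurable torus_haar" for i n
    by (rule measurable_compose[OF measurable_torus_component])
  then show ?thesis
    unfolding character_def[abs_def] by (intro borel_measurable_prod)
qed

lemma character_L2 [simp]: "character \<alpha> \<in> Lp 2"
  by (rule L2_bounded[of _ 1]) auto

text \<open>Independence factors the integral over the coordinates, and a nonzero \<alpha> has a key
  whose factor integrates to 0.\<close>

lemma integral_character: "(LINT z|torus_haar. character \<alpha> z) = (if \<alpha> = 0 then 1 else 0)"
proof -
  let ?A = "Poly_Mapping.keys \<alpha>" and ?n = "Poly_Mapping.lookup \<alpha>"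
  have pow: "(\<lambda>z::complex. z powi n) \<in> borel_measurable circle_haar" for n
  proof -
    have "(\<lambda>z::complex. z powi n) \<in> borel_measurable borel"
      unfolding power_int_def by measurable
    then show ?thesis by (rule measurable_compose[OF id_measurable_circle_haar])
  qed
  have "torus.indep_vars (\<lambda>_. circle_haar) (\<lambda>i z. z i) ?A"
    by (rule torus.indep_vars_subset[OF indep_torus_components]) simp
  then have "torus.indep_vars (\<lambda>_. borel) (\<lambda>i z. z i powi ?n i) ?A"
    by (rule torus.indep_vars_compose2) (rule pow)
  moreover have comp: "(\<lambda>z. z i) \<in> torus_haar \<rightarrow>\<^sub>M circle_haar" for i
    by (simp add: torus_haar_def)
  moreover have "integrable torus_haar (\<lambda>z. z i powi m)" for i m
    by (rule torus.integrable_const_bound[of _ 1])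
      (auto simp: norm_power_int intro!: AE_I2 measurable_compose[OF comp pow])
  ultimately have "(LINT z|torus_haar. character \<alpha> z) = (\<Prod>i\<in>?A. LINT z|torus_haar. z i powi ?n i)"
    unfolding character_def by (intro torus.indep_vars_lebesgue_integral) auto
  also have "\<dots> = (\<Prod>i\<in>?A. if ?n i = 0 then 1 else 0)"
  proof (rule prod.cong[OF refl])
    fix i
    let ?m = "?n i"
    have "(LINT z|torus_haar. z i powi ?m) =
        (LINT x|distr torus_haar circle_haar (\<lambda>z. z i). x powi ?m)"
      by (rule integral_distr[OF comp pow, symmetric])
    then show "(LINT z|torus_haar. z i powi ?m) = (if ?m = 0 then 1 else 0)"
      by (simp add: torus_haar_def circles.PiM_component integral_circle_haar_power_int)
  qed
  also have "\<dots> = (if \<alpha> = 0 then 1 else 0)"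
  proof (cases "\<alpha> = 0")
    case False
    then obtain i where "i \<in> ?A" by (metis all_not_in_conv keys_eq_empty)
    then have "\<exists>i\<in>?A. (if ?n i = 0 then 1 else 0 :: complex) = 0"
      by (intro bexI[of _ i]) (auto simp: in_keys_iff)
    from prod_zero[OF finite_keys this] show ?thesis using False by simp
  qed simp
  finally show ?thesis .
qed

lemma L2_inner_character: "L2_inner (character \<alpha>) (character \<beta>) = (if \<alpha> = \<beta> then 1 else 0)"
proof -
  have "L2_inner (character \<alpha>) (character \<beta>) = (LINT z|torus_haar. character (\<alpha> - \<beta>) z)"
    unfolding L2_inner_def
    by (rule Bochner_Integration.integral_cong) (simp_all add: character_diff)
  then show ?thesis by (simp add: integral_character)
qed

lemma fourier_coeff_character: "fourier_coeff (character \<alpha>) \<beta> = (if \<alpha> = \<beta> then 1 else 0)"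
  by (simp add: fourier_coeff_def L2_inner_character)

lemma L2_character_mult [intro]: "f \<in> Lp 2 \<Longrightarrow> (\<lambda>z. character \<alpha> z * f z) \<in> Lp 2"
  using L2_mult_bounded[of f "character \<alpha>" 1] by (simp add: mult.commute)

lemma fourier_coeff_character_mult:
  "fourier_coeff (\<lambda>z. character \<alpha> z * f z) \<beta> = fourier_coeff f (\<beta> - \<alpha>)"
  unfolding fourier_coeff_def L2_inner_def
  by (rule Bochner_Integration.integral_cong) (simp_all add: character_diff mult_ac)

section \<open>The Hardy space\<close>

lemma H2_L2: "f \<in> H2 \<Longrightarrow> f \<in> Lp 2"
  by (simp add: H2_def)

text \<open>Each Fourier coefficient is linear and continuous in the L2 norm, so the vanishing of
  those with a negative exponent passes to sums, multiples and limits.\<close>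

lemma L2_closed_subspace_H2: "L2_closed_subspace H2"
  unfolding L2_closed_subspace_def
proof (intro conjI ballI allI impI)
  show "H2 \<subseteq> Lp 2" by (auto simp: H2_def)
  show "(\<lambda>_. 0) \<in> H2" by (simp add: H2_def fourier_coeff_def L2_inner_def)
  show "(\<lambda>z. f z + g z) \<in> H2" if "f \<in> H2" "g \<in> H2" for f g
    using that by (auto simp: H2_def fourier_coeff_def L2_inner_add_left)
      (metis add_cancel_left_left)
  show "(\<lambda>z. c * f z) \<in> H2" if "f \<in> H2" for f c
    using that by (auto simp: H2_def fourier_coeff_def L2_inner_cmult_left)
next
  fix F f
  assume F: "\<forall>n. F n \<in> H2" and f: "f \<in> Lp 2" and lim: "(\<lambda>n. L2_norm (\<lambda>z. f z - F n z)) \<longlonglongrightarrow> 0"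
  have "fourier_coeff f \<alpha> = 0" if "\<not> nonneg_exponent \<alpha>" for \<alpha>
  proof -
    have "(\<lambda>n. L2_inner (F n) (character \<alpha>)) \<longlonglongrightarrow> L2_inner f (character \<alpha>)"
      by (rule tendsto_L2_inner_left) (use F f lim in \<open>auto simp: H2_def\<close>)
    moreover have "L2_inner (F n) (character \<alpha>) = 0" for n
      using F that by (auto simp: H2_def fourier_coeff_def)
    ultimately show ?thesis
      by (simp add: fourier_coeff_def LIMSEQ_const_iff)
  qed
  then show "f \<in> H2" using f by (auto simp: H2_def)
qed

lemma conj_H2_iff: "f \<in> conj_H2 \<longleftrightarrow> (\<lambda>z. cnj (f z)) \<in> H2"
proof
  assume "(\<lambda>z. cnj (f z)) \<in> H2"
  then have "(\<lambda>z. cnj (cnj (f z))) \<in> conj_H2" unfolding conj_H2_def by (rule imageI)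
  then show "f \<in> conj_H2" by simp
qed (auto simp: conj_H2_def)

lemma conj_H2_L2: "f \<in> conj_H2 \<Longrightarrow> f \<in> Lp 2"
  by (auto simp: conj_H2_def H2_def)

lemma L2_closed_subspace_conj_H2: "L2_closed_subspace conj_H2"
  unfolding L2_closed_subspace_def
proof (intro conjI ballI allI impI)
  note H2 = L2_closed_subspace_H2[unfolded L2_closed_subspace_def]
  show "conj_H2 \<subseteq> Lp 2" using conj_H2_L2 by blast
  show "(\<lambda>_. 0) \<in> conj_H2" using H2 by (simp add: conj_H2_iff)
  show "(\<lambda>z. f z + g z) \<in> conj_H2" if "f \<in> conj_H2" "g \<in> conj_H2" for f g
    using that H2 by (simp add: conj_H2_iff)
  show "(\<lambda>z. c * f z) \<in> conj_H2" if "f \<in> conj_H2" for f c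
    using that H2 by (simp add: conj_H2_iff)
next
  fix F f
  assume F: "\<forall>n. F n \<in> conj_H2" and f: "f \<in> Lp 2"
    and lim: "(\<lambda>n. L2_norm (\<lambda>z. f z - F n z)) \<longlonglongrightarrow> 0"
  have "L2_norm (\<lambda>z. cnj (f z) - cnj (F n z)) = L2_norm (\<lambda>z. f z - F n z)" for n
    using L2_norm_cnj[of "\<lambda>z. f z - F n z"] by simp
  then have "(\<lambda>n. L2_norm (\<lambda>z. cnj (f z) - cnj (F n z))) \<longlonglongrightarrow> 0"
    using lim by simp
  moreover have "\<forall>n. (\<lambda>z. cnj (F n z)) \<in> H2"
    using F by (simp add: conj_H2_iff)
  moreover have "\<forall>F f. (\<forall>n. F n \<in> H2) \<longrightarrow> f \<in> Lp 2 \<longrightarrow>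
      (\<lambda>n. L2_norm (\<lambda>z. f z - F n z)) \<longlonglongrightarrow> 0 \<longrightarrow> f \<in> H2"
    using L2_closed_subspace_H2 unfolding L2_closed_subspace_def by (elim conjE)
  ultimately have "(\<lambda>z. cnj (f z)) \<in> H2"
    using L2_cnj[OF f] by (elim allE[of _ "\<lambda>n z. cnj (F n z)"] allE[of _ "\<lambda>z. cnj (f z)"]) simp
  then show "f \<in> conj_H2" by (simp add: conj_H2_iff)
qed

lemma character_H2: "nonneg_exponent \<alpha> \<Longrightarrow> character \<alpha> \<in> H2"
  by (auto simp: H2_def fourier_coeff_character split: if_splits)

lemma H2_add: "f \<in> H2 \<Longrightarrow> g \<in> H2 \<Longrightarrow> (\<lambda>z. f z + g z) \<in> H2"
  using L2_closed_subspace_H2 by (simp add: L2_closed_subspace_def)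

lemma H2_cmult: "f \<in> H2 \<Longrightarrow> (\<lambda>z. c * f z) \<in> H2"
  using L2_closed_subspace_H2 by (simp add: L2_closed_subspace_def)

lemma H2_sum: "(\<And>i. i \<in> A \<Longrightarrow> f i \<in> H2) \<Longrightarrow> (\<lambda>z. \<Sum>i\<in>A. f i z) \<in> H2"
proof (induction A rule: infinite_finite_induct)
  case (insert x A)
  then show ?case using H2_add[of "f x" "\<lambda>z. \<Sum>i\<in>A. f i z"] by simp
qed (use L2_closed_subspace_H2 in \<open>auto simp: L2_closed_subspace_def\<close>)

section \<open>Orthonormal families\<close>

lemma L2_norm_sq_orthonormal_sum:
  assumes "finite S" "\<And>s. s \<in> S \<Longrightarrow> e s \<in> Lp 2"
    and "\<And>s t. s \<in> S \<Longrightarrow> t \<in> S \<Longrightarrow> L2_inner (e s) (e t) = (if s = t then 1 else 0)"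
  shows "(L2_norm (\<lambda>z. \<Sum>s\<in>S. c s * e s z))\<^sup>2 = (\<Sum>s\<in>S. (norm (c s))\<^sup>2)"
proof -
  let ?f = "\<lambda>z. \<Sum>s\<in>S. c s * e s z"
  have f: "?f \<in> Lp 2" by (intro L2_sum L2_cmult assms(2))
  have "L2_inner ?f ?f = (\<Sum>s\<in>S. \<Sum>t\<in>S. c s * (cnj (c t) * L2_inner (e s) (e t)))"
  proof -
    have "L2_inner ?f ?f = (\<Sum>s\<in>S. L2_inner (\<lambda>z. c s * e s z) ?f)"
      by (rule L2_inner_sum_left) (use assms(2) f in auto)
    also have "\<dots> = (\<Sum>s\<in>S. \<Sum>t\<in>S. L2_inner (\<lambda>z. c s * e s z) (\<lambda>z. c t * e t z))"
      by (intro sum.cong refl L2_inner_sum_right) (use assms(2) in auto)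
    finally show ?thesis by (simp add: L2_inner_cmult_left L2_inner_cmult_right mult_ac)
  qed
  also have "\<dots> = (\<Sum>s\<in>S. \<Sum>t\<in>S. if s = t then c s * cnj (c t) else 0)"
    using assms(3) by (intro sum.cong refl) auto
  also have "\<dots> = (\<Sum>s\<in>S. c s * cnj (c s))"
    using assms(1) by simp
  also have "\<dots> = of_real (\<Sum>s\<in>S. (norm (c s))\<^sup>2)"
    by (simp add: complex_norm_square[symmetric])
  finally show ?thesis
    unfolding L2_inner_self of_real_eq_iff .
qed

lemma L2_Bessel:
  assumes "finite S" "\<And>s. s \<in> S \<Longrightarrow> e s \<in> Lp 2"
    and "\<And>s t. s \<in> S \<Longrightarrow> t \<in> S \<Longrightarrow> L2_inner (e s) (e t) = (if s = t then 1 else 0)"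
    and f: "f \<in> Lp 2"
  shows "(\<Sum>s\<in>S. (norm (L2_inner f (e s)))\<^sup>2) \<le> (L2_norm f)\<^sup>2"
proof -
  let ?c = "\<lambda>s. L2_inner f (e s)"
  let ?p = "\<lambda>z. \<Sum>s\<in>S. ?c s * e s z"
  have p: "?p \<in> Lp 2" by (intro L2_sum L2_cmult assms(2))
  have "L2_inner f ?p = (\<Sum>s\<in>S. L2_inner f (\<lambda>z. ?c s * e s z))"
    by (rule L2_inner_sum_right) (use assms(2) f in auto)
  also have "\<dots> = of_real (\<Sum>s\<in>S. (norm (?c s))\<^sup>2)"
    unfolding L2_inner_cmult_right by (simp add: complex_norm_square[symmetric] mult.commute[of "cnj _"])
  finally have "Re (L2_inner f ?p) = (\<Sum>s\<in>S. (norm (?c s))\<^sup>2)"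
    by (simp del: of_real_sum)
  then have "(L2_norm (\<lambda>z. f z - ?p z))\<^sup>2 = (L2_norm f)\<^sup>2 - (\<Sum>s\<in>S. (norm (?c s))\<^sup>2)"
    using L2_norm_sq_diff[OF f p] L2_norm_sq_orthonormal_sum[OF assms(1-3), of ?c] by simp
  moreover have "0 \<le> (L2_norm (\<lambda>z. f z - ?p z))\<^sup>2" by simp
  ultimately show ?thesis by linarith
qed

section \<open>Square-free monomials and transversals of the pairs of variables\<close>

definition set_exponent :: "nat set \<Rightarrow> nat \<Rightarrow>\<^sub>0 int" where
  "set_exponent X = (\<Sum>i\<in>X. Poly_Mapping.single i 1)"

lemma lookup_set_exponent:
  "finite X \<Longrightarrow> Poly_Mapping.lookup (set_exponent X) i = (if i \<in> X then 1 else 0)"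
  by (simp add: set_exponent_def lookup_sum lookup_single when_def)

lemma keys_set_exponent: "finite X \<Longrightarrow> Poly_Mapping.keys (set_exponent X) = X"
  by (auto simp: in_keys_iff lookup_set_exponent split: if_splits)

lemma set_exponent_inj: "finite X \<Longrightarrow> finite Y \<Longrightarrow> set_exponent X = set_exponent Y \<longleftrightarrow> X = Y"
  by (metis keys_set_exponent)

lemma nonneg_set_exponent: "finite X \<Longrightarrow> nonneg_exponent (set_exponent X)"
  by (simp add: nonneg_exponent_def lookup_set_exponent)

lemma set_exponent_diff:
  "finite X \<Longrightarrow> U \<subseteq> X \<Longrightarrow> set_exponent X - set_exponent U = set_exponent (X - U)"
  by (rule poly_mapping_eqI) (auto simp: lookup_minus lookup_set_exponent finite_subset)

lemma character_set_exponent: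
  assumes "finite X"
  shows "character (set_exponent X) z = (\<Prod>i\<in>X. z i)"
  by (simp add: character_def keys_set_exponent assms lookup_set_exponent cong: prod.cong)

text \<open>\<open>i div 2\<close> is the number of the pair that contains variable
  \<open>i\<close>, so a transversal picks exactly one variable from each pair in \<open>I\<close>.
  These are the monomials that appear when the product of the pair sums over \<open>I\<close> is
  multiplied out.\<close>

definition transversals :: "nat set \<Rightarrow> nat set set" where
  "transversals I = {X. bij_betw (\<lambda>i. i div 2) X I}"

lemma transversal_image: "X \<in> transversals I \<Longrightarrow> (\<lambda>i. i div 2) ` X = I"
  by (simp add: transversals_def bij_betw_def)

lemma finite_transversal: "finite I \<Longrightarrow> X \<in> transversals I \<Longrightarrow> finite X"
  by (simp add: transversals_def bij_betw_finite)

lemma transversals_empty [simp]: "transversals {} = {{}}"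
  by (auto simp: transversals_def bij_betw_def)

lemma transversals_subset:
  assumes "X \<in> transversals I" "U \<subseteq> X"
  shows "U \<in> transversals ((\<lambda>i. i div 2) ` U)"
  using assms by (auto simp: transversals_def bij_betw_def inj_on_subset)

lemma transversals_diff:
  assumes "X \<in> transversals I" "U \<subseteq> X"
  shows "X - U \<in> transversals (I - (\<lambda>i. i div 2) ` U)"
proof -
  have "inj_on (\<lambda>i. i div 2) X" using assms(1) by (simp add: transversals_def bij_betw_def)
  then show ?thesis
    using transversals_subset[OF assms(1), of "X - U"] assms
    by (simp add: inj_on_image_set_diff[of _ X] transversal_image)
qed

lemma transversals_Un:
  assumes "U \<in> transversals S" "V \<in> transversals T" "S \<inter> T = {}"
  shows "U \<union> V \<in> transversals (S \<union> T)" "U \<inter> V = {}"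
proof -
  show "U \<union> V \<in> transversals (S \<union> T)"
    using assms bij_betw_combine by (simp add: transversals_def)
  show "U \<inter> V = {}"
    using assms by (auto simp: transversals_def bij_betw_def)
qed

lemma transversals_singleton: "transversals {j} = {{2 * j}, {2 * j + 1}}"
proof
  show "transversals {j} \<subseteq> {{2 * j}, {2 * j + 1}}"
  proof
    fix X assume X: "X \<in> transversals {j}"
    then have "card X = 1" using bij_betw_same_card by (fastforce simp: transversals_def)
    then obtain i where i: "X = {i}" by (rule card_1_singletonE)
    then have "i div 2 = j" using transversal_image[OF X] by simp
    then have "i = 2 * j \<or> i = 2 * j + 1" by auto
    then show "X \<in> {{2 * j}, {2 * j + 1}}" using i by auto
  qed
qed (auto simp: transversals_def bij_betw_def)

lemma transversals_insert:
  assumes "j \<notin> I"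
  shows "transversals (insert j I) = insert (2 * j) ` transversals I \<union> insert (2 * j + 1) ` transversals I"
proof (intro equalityI subsetI)
  fix X assume X: "X \<in> transversals (insert j I)"
  then obtain i where i: "i \<in> X" "i div 2 = j" using transversal_image[OF X] by force
  have "X - {i} \<in> transversals (insert j I - {j})"
    using transversals_diff[OF X, of "{i}"] i by simp
  then have "X - {i} \<in> transversals I" using assms by simp
  then have "insert i (X - {i}) \<in> insert i ` transversals I" by (rule imageI)
  then have "X \<in> insert i ` transversals I" using i(1) by (simp add: insert_absorb)
  moreover have "i = 2 * j \<or> i = 2 * j + 1" using i(2) by auto
  ultimately show "X \<in> insert (2 * j) ` transversals I \<union> insert (2 * j + 1) ` transversals I"
    by (elim disjE) simp_all
next
  fix X assume "X \<in> insert (2 * j) ` transversals I \<union> insert (2 * j + 1) ` transversals I"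
  then obtain Y i where Y: "Y \<in> transversals I" "X = {i} \<union> Y" "{i} \<in> transversals {j}"
    by (auto simp: transversals_singleton)
  then show "X \<in> transversals (insert j I)"
    using transversals_Un(1)[OF Y(3,1)] assms by simp
qed

lemma transversals_insert_disjoint:
  assumes "j \<notin> I"
  shows "inj_on (insert (2 * j)) (transversals I)" "inj_on (insert (2 * j + 1)) (transversals I)"
    "insert (2 * j) ` transversals I \<inter> insert (2 * j + 1) ` transversals I = {}"
proof -
  have notin: "2 * j \<notin> X" "2 * j + 1 \<notin> X" if "X \<in> transversals I" for X
    using transversal_image[OF that] assms by force+
  show "inj_on (insert (2 * j)) (transversals I)" "inj_on (insert (2 * j + 1)) (transversals I)"
    using notin by (meson inj_onI insert_ident)+
  have False if "insert (2 * j) X = insert (2 * j + 1) Y" "Y \<in> transversals I" for X Y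
  proof -
    have "2 * j \<in> insert (2 * j + 1) Y" using that(1) by blast
    then show False using notin(1)[OF that(2)] by simp
  qed
  then show "insert (2 * j) ` transversals I \<inter> insert (2 * j + 1) ` transversals I = {}"
    by blast
qed

lemma finite_transversals: "finite I \<Longrightarrow> finite (transversals I)"
  by (induction I rule: finite_induct) (simp_all add: transversals_insert)

text \<open>Splitting a transversal of \<open>I\<close> in two amounts to splitting \<open>I\<close> in two and choosing a
  transversal of each part.\<close>

lemma sum_transversals_split:
  fixes F G :: "nat set \<Rightarrow> 'a :: comm_semiring_0"
  assumes "finite I"
  shows "(\<Sum>X\<in>transversals I. \<Sum>U\<in>Pow X. F U * G (X - U)) =
    (\<Sum>S\<in>Pow I. (\<Sum>U\<in>transversals S. F U) * (\<Sum>V\<in>transversals (I - S). G V))"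
proof -
  have fin: "finite (transversals S)" if "S \<subseteq> I" for S
    using that assms by (intro finite_transversals) (rule finite_subset)
  have "(\<Sum>X\<in>transversals I. \<Sum>U\<in>Pow X. F U * G (X - U)) =
      (\<Sum>(X, U)\<in>Sigma (transversals I) Pow. F U * G (X - U))"
    using fin finite_transversal[OF assms(1)] by (intro sum.Sigma) auto
  \<comment> \<open>A transversal with a marked subset corresponds to the set of pairs that the
    subset meets, the subset, and its complement; the union undoes this.\<close>
  also have "\<dots> = (\<Sum>(S, U, V)\<in>Sigma (Pow I) (\<lambda>S. transversals S \<times> transversals (I - S)). F U * G V)"
  proof (rule sum.reindex_bij_witness[where
      i = "\<lambda>(S, U, V). (U \<union> V, U)" and j = "\<lambda>(X, U). ((\<lambda>i. i div 2) ` U, U, X - U)"], goal_cases)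
    case (1 a) then show ?case by auto
  next
    case (2 a)
    then obtain X U where a: "a = (X, U)" "X \<in> transversals I" "U \<subseteq> X" by auto
    then show ?case
      using transversals_subset[OF a(2,3)] transversals_diff[OF a(2,3)] transversal_image[OF a(2)] by auto
  next
    case (3 b)
    then obtain S U V where b: "b = (S, U, V)" "S \<subseteq> I" "U \<in> transversals S" "V \<in> transversals (I - S)"
      by auto
    then show ?case
      using transversals_Un[OF b(3,4)] transversal_image[OF b(3)] by auto
  next
    case (4 b)
    then obtain S U V where b: "b = (S, U, V)" "S \<subseteq> I" "U \<in> transversals S" "V \<in> transversals (I - S)"
      by auto
    then have "S \<union> (I - S) = I" by auto
    then show ?case using transversals_Un(1)[OF b(3,4)] b by auto
  next
    case (5 a) then show ?case by auto
  qed
  also have "\<dots> = (\<Sum>S\<in>Pow I. \<Sum>(U, V)\<in>transversals S \<times> transversals (I - S). F U * G V)"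
    using assms(1) fin by (subst sum.Sigma) auto
  also have "\<dots> = (\<Sum>S\<in>Pow I. (\<Sum>U\<in>transversals S. F U) * (\<Sum>V\<in>transversals (I - S). G V))"
    by (simp add: sum_product sum.cartesian_product)
  finally show ?thesis .
qed

lemma sum_transversals_insert:
  assumes "finite I" "j \<notin> I"
  shows "(\<Sum>X\<in>transversals (insert j I). f X) =
    (\<Sum>X\<in>transversals I. f (insert (2 * j) X)) + (\<Sum>X\<in>transversals I. f (insert (2 * j + 1) X))"
  using transversals_insert_disjoint[OF assms(2)] finite_transversals[OF assms(1)]
  by (simp add: transversals_insert[OF assms(2)] sum.union_disjoint sum.reindex)

lemma card_transversals: "finite I \<Longrightarrow> card (transversals I) = 2 ^ card I"
  by (induction I rule: finite_induct) (simp_all add: card_eq_sum sum_transversals_insert del: sum_constant)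

section \<open>Products of normalized sums of pairs\<close>

definition pair_mean :: "nat \<Rightarrow> (nat \<Rightarrow> complex) \<Rightarrow> complex" where
  "pair_mean j z = (z (2 * j) + z (2 * j + 1)) / complex_of_real (sqrt 2)"

text \<open>For the empty set this is the constant 1, so the inner product with
  \<open>pair_prod {}\<close> is the constant coefficient. It belongs to the subsets of every
  block.\<close>

definition pair_prod :: "nat set \<Rightarrow> (nat \<Rightarrow> complex) \<Rightarrow> complex" where
  "pair_prod I z = (\<Prod>j\<in>I. pair_mean j z)"

lemma pair_prod_expand:
  assumes "finite I"
  shows "pair_prod I z =
    (\<Sum>X\<in>transversals I. complex_of_real ((1 / sqrt 2) ^ card I) * character (set_exponent X) z)"
proof -
  have "pair_prod I z = complex_of_real ((1 / sqrt 2) ^ card I) * (\<Sum>X\<in>transversals I. \<Prod>i\<in>X. z i)"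
    using assms
  proof (induction I rule: finite_induct)
    case (insert j I)
    have "2 * j \<notin> X" "2 * j + 1 \<notin> X" "finite X" if "X \<in> transversals I" for X
      using transversal_image[OF that] insert(2) finite_transversal[OF insert(1) that] by force+
    then have "(\<Sum>X\<in>transversals (insert j I). \<Prod>i\<in>X. z i) =
        (z (2 * j) + z (2 * j + 1)) * (\<Sum>X\<in>transversals I. \<Prod>i\<in>X. z i)"
      unfolding sum_transversals_insert[OF insert(1,2)]
      by (simp add: distrib_right sum_distrib_left sum.distrib)
    then show ?case
      using insert by (simp add: pair_prod_def pair_mean_def)
  qed (simp add: pair_prod_def)
  then show ?thesis
    by (simp add: sum_distrib_left character_set_exponent finite_transversal[OF assms])
qed

lemma pair_prod_expand_fun:
  assumes "finite I"
  shows "pair_prod I =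
    (\<lambda>z. \<Sum>X\<in>transversals I. complex_of_real ((1 / sqrt 2) ^ card I) * character (set_exponent X) z)"
  by (rule ext) (rule pair_prod_expand[OF assms])

lemma pair_prod_H2: "finite I \<Longrightarrow> pair_prod I \<in> H2"
  unfolding pair_prod_expand_fun
  by (intro H2_sum H2_cmult character_H2 nonneg_set_exponent) (auto intro: finite_transversal)

lemma pair_prod_L2: "finite I \<Longrightarrow> pair_prod I \<in> Lp 2"
  by (intro H2_L2 pair_prod_H2)

lemma L2_inner_pair_prod_right:
  assumes "finite I" "f \<in> Lp 2"
  shows "L2_inner f (pair_prod I) =
    complex_of_real ((1 / sqrt 2) ^ card I) * (\<Sum>X\<in>transversals I. fourier_coeff f (set_exponent X))"
proof -
  have "L2_inner f (pair_prod I) =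
      (\<Sum>X\<in>transversals I. L2_inner f (\<lambda>z. complex_of_real ((1 / sqrt 2) ^ card I) * character (set_exponent X) z))"
    unfolding pair_prod_expand_fun[OF assms(1)]
    by (rule L2_inner_sum_right) (use assms(2) in auto)
  then show ?thesis
    unfolding L2_inner_cmult_right fourier_coeff_def by (simp add: sum_distrib_left)
qed

lemma fourier_coeff_pair_prod:
  assumes "finite I" "finite X"
  shows "fourier_coeff (pair_prod I) (set_exponent X) =
    (if X \<in> transversals I then complex_of_real ((1 / sqrt 2) ^ card I) else 0)"
proof -
  have "fourier_coeff (pair_prod I) (set_exponent X) = (\<Sum>Y\<in>transversals I.
      L2_inner (\<lambda>z. complex_of_real ((1 / sqrt 2) ^ card I) * character (set_exponent Y) z)
        (character (set_exponent X)))"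
    unfolding pair_prod_expand_fun[OF assms(1)] fourier_coeff_def
    by (rule L2_inner_sum_left) auto
  also have "\<dots> = (\<Sum>Y\<in>transversals I. if Y = X then complex_of_real ((1 / sqrt 2) ^ card I) else 0)"
    unfolding L2_inner_cmult_left L2_inner_character
    using assms finite_transversal[OF assms(1)] by (intro sum.cong) (auto simp: set_exponent_inj)
  finally show ?thesis
    using finite_transversals[OF assms(1)] by simp
qed

text \<open>A transversal determines its index set as its image under \<open>i div 2\<close>, so
  different index sets have no monomial in common. For equal ones, 2^(card I) monomials contribute
  2^(-card I) each.\<close>

lemma L2_inner_pair_prod:
  assumes "finite I" "finite J"
  shows "L2_inner (pair_prod I) (pair_prod J) = (if I = J then 1 else 0)"
proof -
  have "L2_inner (pair_prod I) (pair_prod J) = complex_of_real ((1 / sqrt 2) ^ card J) *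
      (\<Sum>X\<in>transversals J. if X \<in> transversals I then complex_of_real ((1 / sqrt 2) ^ card I) else 0)"
    unfolding L2_inner_pair_prod_right[OF assms(2) pair_prod_L2[OF assms(1)]]
    using assms finite_transversal by (auto simp: fourier_coeff_pair_prod intro!: sum.cong)
  also have "\<dots> = (if I = J then 1 else 0)"
  proof (cases "I = J")
    case True
    have "((1 / sqrt 2) ^ card I) * (2 ^ card I * (1 / sqrt 2) ^ card I) = (1 :: real)"
      unfolding power_mult_distrib[symmetric] by simp
    then have "complex_of_real (((1 / sqrt 2) ^ card I) * (2 ^ card I * (1 / sqrt 2) ^ card I)) = 1"
      by (simp only: of_real_1)
    then show ?thesis using True assms by (simp add: card_transversals)
  next
    case False
    then have "X \<notin> transversals I" if "X \<in> transversals J" for X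
      using transversal_image[OF that] transversal_image[of X I] by auto
    then show ?thesis using False by simp
  qed
  finally show ?thesis .
qed

lemma L2_norm_pair_prod: "finite I \<Longrightarrow> L2_norm (pair_prod I) = 1"
  using L2_norm_eqI[of "pair_prod I" "\<lambda>_. 1"] L2_inner_self[of "\<lambda>_. 1"]
  by (simp add: L2_inner_pair_prod L2_norm_const)

section \<open>The bilinear form of the Hankel operator\<close>

lemma analytic_polynomial_H2: "f \<in> analytic_polynomials \<Longrightarrow> f \<in> H2"
  by (auto simp: analytic_polynomials_def intro!: H2_sum H2_cmult character_H2)

lemma analytic_polynomial_bounded:
  assumes "f \<in> analytic_polynomials"
  obtains B where "\<And>z. z \<in> space torus_haar \<Longrightarrow> norm (f z) \<le> B"
proof -
  obtain A c where f: "f = (\<lambda>z. \<Sum>\<alpha>\<in>A. c \<alpha> * character \<alpha> z)"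
    using assms by (auto simp: analytic_polynomials_def)
  show ?thesis
    by (rule that[of "\<Sum>\<alpha>\<in>A. norm (c \<alpha>)"])
      (auto simp: f norm_mult intro!: order_trans[OF norm_sum] sum_mono)
qed

lemma analytic_polynomial_mult_L2:
  assumes "f \<in> analytic_polynomials" "g \<in> Lp 2"
  shows "(\<lambda>z. f z * g z) \<in> Lp 2"
proof -
  obtain B where B: "\<And>z. z \<in> space torus_haar \<Longrightarrow> norm (f z) \<le> B"
    using analytic_polynomial_bounded[OF assms(1)] by blast
  show ?thesis
    using L2_mult_bounded[OF assms(2) L2_measurable[OF H2_L2[OF analytic_polynomial_H2[OF assms(1)]]] B]
    by (simp add: mult.commute)
qed

text \<open>The convolution formula for the coefficients of a product, finite because
  \<open>f\<close> is a polynomial. Since both factors have only nonnegative exponents, only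
  divisors of the square-free monomial on \<open>X\<close> contribute, and these are the monomials
  of subsets of \<open>X\<close>.\<close>

lemma fourier_coeff_mult:
  assumes f: "f \<in> analytic_polynomials" and g: "g \<in> H2" and X: "finite X"
  shows "fourier_coeff (\<lambda>z. f z * g z) (set_exponent X) =
    (\<Sum>U\<in>Pow X. fourier_coeff f (set_exponent U) * fourier_coeff g (set_exponent (X - U)))"
proof -
  obtain A c where A: "finite A" "\<forall>\<alpha>\<in>A. nonneg_exponent \<alpha>" and f: "f = (\<lambda>z. \<Sum>\<alpha>\<in>A. c \<alpha> * character \<alpha> z)"
    using f by (auto simp: analytic_polynomials_def)
  let ?E = "set_exponent ` Pow X"
  note gL = H2_L2[OF g]
  have fU: "fourier_coeff f \<beta> = (if \<beta> \<in> A then c \<beta> else 0)" for \<beta>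
  proof -
    have "fourier_coeff f \<beta> = (\<Sum>\<alpha>\<in>A. L2_inner (\<lambda>z. c \<alpha> * character \<alpha> z) (character \<beta>))"
      unfolding f fourier_coeff_def by (rule L2_inner_sum_left) auto
    then show ?thesis
      unfolding L2_inner_cmult_left L2_inner_character using A(1) by (simp add: if_distrib cong: if_cong)
  qed
  \<comment> \<open>If the complementary coefficient of \<open>g\<close> does not vanish, then
    \<alpha> lies between 0 and the exponent of \<open>X\<close> in each coordinate, so it is the
    indicator of a subset of \<open>X\<close>.\<close>
  have zero: "fourier_coeff g (set_exponent X - \<alpha>) = 0" if "\<alpha> \<in> A" "\<alpha> \<notin> ?E" for \<alpha>
  proof (rule ccontr)
    assume "fourier_coeff g (set_exponent X - \<alpha>) \<noteq> 0"
    then have "nonneg_exponent (set_exponent X - \<alpha>)"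
      using g by (simp add: H2_def)
    then have le: "Poly_Mapping.lookup \<alpha> i \<le> (if i \<in> X then 1 else 0)" for i
      by (auto simp: nonneg_exponent_def lookup_minus lookup_set_exponent[OF X] dest!: spec[of _ i])
    have ge: "0 \<le> Poly_Mapping.lookup \<alpha> i" for i
      using A(2) that(1) by (auto simp: nonneg_exponent_def)
    have "Poly_Mapping.keys \<alpha> \<subseteq> X"
    proof
      fix i assume "i \<in> Poly_Mapping.keys \<alpha>"
      then show "i \<in> X" using le[of i] ge[of i] by (auto simp: in_keys_iff split: if_splits)
    qed
    moreover have "\<alpha> = set_exponent (Poly_Mapping.keys \<alpha>)"
    proof (rule poly_mapping_eqI)
      fix i
      show "Poly_Mapping.lookup \<alpha> i = Poly_Mapping.lookup (set_exponent (Poly_Mapping.keys \<alpha>)) i"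
        using le[of i] ge[of i] by (auto simp: lookup_set_exponent in_keys_iff split: if_splits)
    qed
    ultimately show False using that(2) by blast
  qed
  have "fourier_coeff (\<lambda>z. f z * g z) (set_exponent X) =
      (\<Sum>\<alpha>\<in>A. L2_inner (\<lambda>z. c \<alpha> * (character \<alpha> z * g z)) (character (set_exponent X)))"
    unfolding f fourier_coeff_def sum_distrib_right mult.assoc
    by (rule L2_inner_sum_left) (use gL in auto)
  also have "\<dots> = (\<Sum>\<alpha>\<in>A. c \<alpha> * fourier_coeff g (set_exponent X - \<alpha>))"
    unfolding L2_inner_cmult_left by (simp add: fourier_coeff_character_mult flip: fourier_coeff_def)
  also have "\<dots> = (\<Sum>\<alpha>\<in>A \<inter> ?E. c \<alpha> * fourier_coeff g (set_exponent X - \<alpha>))"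
    using A(1) zero by (intro sum.mono_neutral_right) auto
  also have "\<dots> = (\<Sum>\<alpha>\<in>A \<inter> ?E. fourier_coeff f \<alpha> * fourier_coeff g (set_exponent X - \<alpha>))"
    by (simp add: fU)
  also have "\<dots> = (\<Sum>\<alpha>\<in>?E. fourier_coeff f \<alpha> * fourier_coeff g (set_exponent X - \<alpha>))"
    using X by (intro sum.mono_neutral_left) (auto simp: fU)
  also have "\<dots> = (\<Sum>U\<in>Pow X. fourier_coeff f (set_exponent U) * fourier_coeff g (set_exponent X - set_exponent U))"
    using X by (subst sum.reindex) (auto intro!: inj_onI simp: set_exponent_inj finite_subset)
  also have "\<dots> = (\<Sum>U\<in>Pow X. fourier_coeff f (set_exponent U) * fourier_coeff g (set_exponent (X - U)))"
    using X by (intro sum.cong) (auto simp: set_exponent_diff)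
  finally show ?thesis .
qed

text \<open>Convolution on each transversal is regrouped by the splitting of transversals; the
  normalizing factors match because \<open>card I = card S + card (I - S)\<close>.\<close>

lemma L2_inner_mult_pair_prod:
  assumes f: "f \<in> analytic_polynomials" and g: "g \<in> H2" and I: "finite I"
  shows "L2_inner (\<lambda>z. f z * g z) (pair_prod I) =
    (\<Sum>S\<in>Pow I. L2_inner f (pair_prod S) * L2_inner g (pair_prod (I - S)))"
proof -
  have fL: "f \<in> Lp 2" and gL: "g \<in> Lp 2"
    using f g by (auto intro: H2_L2 analytic_polynomial_H2)
  have fg: "(\<lambda>z. f z * g z) \<in> Lp 2"
    by (rule analytic_polynomial_mult_L2[OF f gL])
  let ?F = "\<lambda>U. fourier_coeff f (set_exponent U)" and ?G = "\<lambda>U. fourier_coeff g (set_exponent U)"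
  let ?r = "\<lambda>I::nat set. complex_of_real ((1 / sqrt 2) ^ card I)"
  have "L2_inner (\<lambda>z. f z * g z) (pair_prod I) =
      ?r I * (\<Sum>X\<in>transversals I. \<Sum>U\<in>Pow X. ?F U * ?G (X - U))"
    unfolding L2_inner_pair_prod_right[OF I fg]
    by (simp add: fourier_coeff_mult[OF f g] finite_transversal[OF I] cong: sum.cong)
  also have "\<dots> = (\<Sum>S\<in>Pow I. ?r I * ((\<Sum>U\<in>transversals S. ?F U) * (\<Sum>V\<in>transversals (I - S). ?G V)))"
    unfolding sum_transversals_split[OF I, of ?F ?G] by (rule sum_distrib_left)
  also have "\<dots> = (\<Sum>S\<in>Pow I. L2_inner f (pair_prod S) * L2_inner g (pair_prod (I - S)))"
  proof (rule sum.cong[OF refl])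
    fix S assume "S \<in> Pow I"
    then have S: "finite S" "finite (I - S)" "card I = card S + card (I - S)"
      using I by (auto simp: finite_subset card_Diff_subset card_mono)
    show "?r I * ((\<Sum>U\<in>transversals S. ?F U) * (\<Sum>V\<in>transversals (I - S). ?G V)) =
        L2_inner f (pair_prod S) * L2_inner g (pair_prod (I - S))"
      by (simp add: L2_inner_pair_prod_right fL gL S power_add)
  qed
  finally show ?thesis .
qed

section \<open>The symbol\<close>

text \<open>Pairs are numbered from 0 while the product in the symbol runs over indices from 1,
  hence the half-open interval between consecutive triangular numbers. \<open>block 0\<close> is
  empty.\<close>

definition block :: "nat \<Rightarrow> nat set" where
  "block k = {(k - 1) * k div 2..<k * (k + 1) div 2}"

definition weight :: "nat \<Rightarrow> real" where
  "weight k = sqrt 6 / pi / real k"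

lemma finite_block [simp]: "finite (block k)"
  by (simp add: block_def)

lemma card_block: "card (block k) = k"
proof (cases k)
  case (Suc m)
  \<comment> \<open>The difference of the two products is twice the block length, so
    \<open>div 2\<close> splits exactly.\<close>
  have "Suc m * (Suc m + 1) = m * Suc m + 2 * Suc m" by simp
  then show ?thesis using Suc by (simp add: block_def)
qed (simp add: block_def)

lemma block_disjoint_less:
  assumes "k < l"
  shows "block k \<inter> block l = {}"
proof -
  have "k * (k + 1) \<le> (l - 1) * l" using assms by (intro mult_le_mono) auto
  then have "k * (k + 1) div 2 \<le> (l - 1) * l div 2" by (rule div_le_mono)
  then show ?thesis by (auto simp: block_def)
qed

lemma block_disjoint: "k \<noteq> l \<Longrightarrow> block k \<inter> block l = {}"
  using block_disjoint_less[of k l] block_disjoint_less[of l k] by (auto simp: linorder_neq_iff)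

lemma block_eq_iff: "block k = block l \<longleftrightarrow> k = l"
  by (metis card_block)

lemma symbol_partial_sum_eq:
  "symbol_partial_sum n z = (\<Sum>k=1..n. complex_of_real (weight k) * pair_prod (block k) z)"
proof -
  have "(\<Prod>j = (k - 1) * k div 2 + 1..k * (k + 1) div 2.
      (z (2 * j - 2) + z (2 * j - 1)) / complex_of_real (sqrt 2)) = pair_prod (block k) z" for k
  proof -
    have "{(k - 1) * k div 2 + 1..k * (k + 1) div 2} = Suc ` block k"
      by (simp add: block_def atLeastLessThanSuc_atLeastAtMost)
    then show ?thesis
      by (simp add: prod.reindex pair_prod_def pair_mean_def)
  qed
  then show ?thesis
    unfolding symbol_partial_sum_def sum_distrib_left
    by (intro sum.cong) (simp_all add: weight_def)
qed

lemma symbol_partial_sum_fun: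
  "symbol_partial_sum n = (\<lambda>z. \<Sum>k\<in>{1..n}. complex_of_real (weight k) * pair_prod (block k) z)"
  by (rule ext) (rule symbol_partial_sum_eq)

lemma symbol_partial_sum_H2: "symbol_partial_sum n \<in> H2"
  unfolding symbol_partial_sum_fun by (intro H2_sum H2_cmult pair_prod_H2 finite_block)

lemma symbol_partial_sum_L2: "symbol_partial_sum n \<in> Lp 2"
  by (intro H2_L2 symbol_partial_sum_H2)

lemma weight_nonneg: "0 \<le> weight k"
  by (simp add: weight_def)

text \<open>Euler's value pi^2/6 for the sum of the inverse squares; the factor
  \<open>sqrt 6 / pi\<close> of the symbol normalizes exactly this.\<close>

lemma weight_sq_sums: "(\<lambda>k. (weight (Suc k))\<^sup>2) sums 1"
proof -
  have "(\<lambda>k. 6 / pi\<^sup>2 * (1 / (real k + 1)\<^sup>2)) sums (6 / pi\<^sup>2 * (pi\<^sup>2 / 6))"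
    using inverse_squares_sums by (intro sums_mult) (simp add: add.commute)
  then show ?thesis
    by (simp add: weight_def power_divide power_mult_distrib add.commute)
qed

lemma sum_weight_sq_le_1: "(\<Sum>k=1..n. (weight k)\<^sup>2) \<le> 1"
proof -
  have "(\<Sum>k=1..n. (weight k)\<^sup>2) = (\<Sum>k<n. (weight (Suc k))\<^sup>2)"
    by (simp add: sum.atLeast1_atMost_eq)
  also have "\<dots> \<le> 1"
    using sum_le_suminf[OF sums_summable[OF weight_sq_sums], of "{..<n}"] sums_unique[OF weight_sq_sums] by simp
  finally show ?thesis .
qed

lemma weight_le_1: "weight k \<le> 1"
proof (cases "k = 0")
  case False
  then have "(weight k)\<^sup>2 \<le> (\<Sum>k=1..k. (weight k)\<^sup>2)"
    by (intro member_le_sum) auto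
  then have "(weight k)\<^sup>2 \<le> 1\<^sup>2" using sum_weight_sq_le_1[of k] by simp
  then show ?thesis by (rule power2_le_imp_le) simp
qed (simp add: weight_def)

lemma L2_norm_sq_block_sum:
  "finite K \<Longrightarrow> (L2_norm (\<lambda>z. \<Sum>k\<in>K. complex_of_real (weight k) * pair_prod (block k) z))\<^sup>2 =
    (\<Sum>k\<in>K. (weight k)\<^sup>2)"
  by (subst L2_norm_sq_orthonormal_sum) (auto simp: L2_inner_pair_prod pair_prod_L2 block_eq_iff)

text \<open>The blocks are orthonormal, so squared distances of partial sums of the symbol are
  differences of partial sums of a convergent numerical series; completeness gives a limit, and
  closedness keeps it in \<open>H2\<close>.\<close>

lemma is_symbol_exists: "\<exists>\<phi>. is_symbol \<phi>"
proof -
  let ?s = "\<lambda>n. \<Sum>k<n. (weight (Suc k))\<^sup>2"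
  have diff: "(L2_norm (\<lambda>z. symbol_partial_sum m z - symbol_partial_sum n z))\<^sup>2 = ?s m - ?s n"
    if "n \<le> m" for m n
  proof -
    have K: "{1..m} = {1..n} \<union> {n<..m}" using that by auto
    have "{1..n} \<inter> {n<..m} = {}" by auto
    then have split: "(\<Sum>k\<in>{1..m}. f k) = (\<Sum>k\<in>{1..n}. f k) + (\<Sum>k\<in>{n<..m}. f k)" for f :: "nat \<Rightarrow> 'b::comm_monoid_add"
      unfolding K by (intro sum.union_disjoint) auto
    have "(L2_norm (\<lambda>z. symbol_partial_sum m z - symbol_partial_sum n z))\<^sup>2 = (\<Sum>k\<in>{n<..m}. (weight k)\<^sup>2)"
      unfolding symbol_partial_sum_eq split
      by (simp add: L2_norm_sq_block_sum)
    also have "\<dots> = (\<Sum>k\<in>{1..m}. (weight k)\<^sup>2) - (\<Sum>k\<in>{1..n}. (weight k)\<^sup>2)"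
      unfolding split by simp
    finally show ?thesis
      by (simp add: sum.atLeast1_atMost_eq)
  qed
  have "\<exists>N. \<forall>m\<ge>N. \<forall>n\<ge>N. L2_norm (\<lambda>z. symbol_partial_sum m z - symbol_partial_sum n z) < e"
    if "e > 0" for e
  proof -
    have "Cauchy ?s"
      using weight_sq_sums by (intro LIMSEQ_imp_Cauchy) (auto simp: sums_def)
    then obtain N where N: "\<And>m n. m \<ge> N \<Longrightarrow> n \<ge> N \<Longrightarrow> dist (?s m) (?s n) < e\<^sup>2"
      using \<open>e > 0\<close> unfolding Cauchy_def by (meson zero_less_power)
    have le: "L2_norm (\<lambda>z. symbol_partial_sum m z - symbol_partial_sum n z) < e" if "N \<le> n" "n \<le> m" for m n
    proof (rule power2_less_imp_less)
      show "(L2_norm (\<lambda>z. symbol_partial_sum m z - symbol_partial_sum n z))\<^sup>2 < e\<^sup>2"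
        using N[of m n] that by (simp add: diff dist_norm)
    qed (use \<open>e > 0\<close> in simp)
    have "L2_norm (\<lambda>z. symbol_partial_sum m z - symbol_partial_sum n z) < e" if "N \<le> n" "N \<le> m" for m n
      using le[of n m] le[of m n] that L2_norm_minus_commute[of "symbol_partial_sum m"]
      by (cases "n \<le> m") auto
    then show ?thesis by blast
  qed
  then obtain \<phi> where \<phi>: "\<phi> \<in> Lp 2" "(\<lambda>n. L2_norm (\<lambda>z. \<phi> z - symbol_partial_sum n z)) \<longlonglongrightarrow> 0"
    using L2_complete[of symbol_partial_sum] symbol_partial_sum_L2 by metis
  have closed: "\<forall>F f. (\<forall>n. F n \<in> H2) \<longrightarrow> f \<in> Lp 2 \<longrightarrow>
      (\<lambda>n. L2_norm (\<lambda>z. f z - F n z)) \<longlonglongrightarrow> 0 \<longrightarrow> f \<in> H2"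
    using L2_closed_subspace_H2 unfolding L2_closed_subspace_def by (elim conjE)
  have "\<phi> \<in> H2"
    by (rule closed[rule_format, OF symbol_partial_sum_H2 \<phi>])
  then show ?thesis using \<phi> by (auto simp: is_symbol_def)
qed

lemma L2_norm_symbol:
  assumes "is_symbol \<phi>"
  shows "L2_norm \<phi> = 1"
proof -
  let ?S = symbol_partial_sum
  have \<phi>: "\<phi> \<in> Lp 2" and lim: "(\<lambda>n. L2_norm (\<lambda>z. \<phi> z - ?S n z)) \<longlonglongrightarrow> 0"
    using assms by (auto simp: is_symbol_def H2_L2)
  have "(\<lambda>n. L2_norm (?S n)) \<longlonglongrightarrow> L2_norm \<phi>"
  proof (rule metric_tendsto_imp_tendsto[OF lim], rule always_eventually, rule allI)
    fix n
    show "dist (L2_norm (?S n)) (L2_norm \<phi>) \<le> dist (L2_norm (\<lambda>z. \<phi> z - ?S n z)) 0"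
      using L2_norm_triangle[OF L2_diff[OF \<phi> symbol_partial_sum_L2[of n]] symbol_partial_sum_L2[of n]]
        L2_norm_triangle[OF L2_diff[OF symbol_partial_sum_L2[of n] \<phi>] \<phi>]
        L2_norm_minus_commute[of "?S n" \<phi>]
      by (simp add: dist_norm abs_le_iff)
  qed
  then have lim_sq: "(\<lambda>n. (L2_norm (?S n))\<^sup>2) \<longlonglongrightarrow> (L2_norm \<phi>)\<^sup>2"
    by (rule tendsto_power)
  have "(L2_norm (?S n))\<^sup>2 = (\<Sum>k<n. (weight (Suc k))\<^sup>2)" for n
    unfolding symbol_partial_sum_fun L2_norm_sq_block_sum[OF finite_atLeastAtMost]
    by (simp add: sum.atLeast1_atMost_eq)
  then have "(\<lambda>n. (L2_norm (?S n))\<^sup>2) \<longlonglongrightarrow> 1"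
    using weight_sq_sums by (simp add: sums_def)
  with lim_sq have "(L2_norm \<phi>)\<^sup>2 = 1"
    by (rule LIMSEQ_unique)
  then show ?thesis
    using L2_norm_ge_0[of \<phi>] by (auto simp: power2_eq_1_iff simp del: L2_norm_ge_0)
qed

lemma L2_inner_symbol_block:
  assumes "is_symbol \<phi>" "k \<ge> 1"
  shows "L2_inner \<phi> (pair_prod (block k)) = complex_of_real (weight k)"
proof -
  let ?S = symbol_partial_sum
  have \<phi>: "\<phi> \<in> Lp 2" and lim: "(\<lambda>n. L2_norm (\<lambda>z. \<phi> z - ?S n z)) \<longlonglongrightarrow> 0"
    using assms by (auto simp: is_symbol_def H2_L2)
  have "(\<lambda>n. L2_inner (?S n) (pair_prod (block k))) \<longlonglongrightarrow> L2_inner \<phi> (pair_prod (block k))"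
    by (rule tendsto_L2_inner_left[OF symbol_partial_sum_L2 \<phi> pair_prod_L2 lim]) simp
  moreover have "\<forall>\<^sub>F n in sequentially. L2_inner (?S n) (pair_prod (block k)) = complex_of_real (weight k)"
  proof (rule eventually_sequentiallyI[of k])
    fix n assume "k \<le> n"
    have "L2_inner (?S n) (pair_prod (block k)) =
        (\<Sum>l\<in>{1..n}. L2_inner (\<lambda>z. complex_of_real (weight l) * pair_prod (block l) z) (pair_prod (block k)))"
      unfolding symbol_partial_sum_fun by (intro L2_inner_sum_left L2_cmult pair_prod_L2 finite_block)
    also have "\<dots> = (\<Sum>l\<in>{1..n}. if l = k then complex_of_real (weight l) else 0)"
      unfolding L2_inner_cmult_left by (intro sum.cong) (auto simp: L2_inner_pair_prod block_eq_iff)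
    also have "\<dots> = complex_of_real (weight k)" using \<open>k \<le> n\<close> assms(2) by simp
    finally show "L2_inner (?S n) (pair_prod (block k)) = complex_of_real (weight k)" .
  qed
  ultimately show ?thesis
    by (rule LIMSEQ_unique[OF _ tendsto_eventually])
qed

section \<open>The norm of the Hankel operator\<close>

text \<open>Only the terms with \<open>S\<close> empty or \<open>S = I k\<close> share variables between different \<open>k\<close>, and for
  these the square summability of the coefficients \<open>c k\<close> is used.\<close>

lemma sum_disjoint_blocks_le:
  fixes a b :: "'a set \<Rightarrow> real"
  assumes K: "finite K" and I: "\<And>k. k \<in> K \<Longrightarrow> finite (I k)" "\<And>k. k \<in> K \<Longrightarrow> I k \<noteq> {}"
    and disj: "\<And>k l. k \<in> K \<Longrightarrow> l \<in> K \<Longrightarrow> k \<noteq> l \<Longrightarrow> I k \<inter> I l = {}"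
    and ab: "\<And>S. 0 \<le> a S" "\<And>S. 0 \<le> b S"
    and c: "\<And>k. k \<in> K \<Longrightarrow> 0 \<le> c k" "\<And>k. k \<in> K \<Longrightarrow> c k \<le> 1" "(\<Sum>k\<in>K. (c k)\<^sup>2) \<le> 1"
  defines "F \<equiv> (\<Union>k\<in>K. Pow (I k))"
  shows "(\<Sum>k\<in>K. c k * (\<Sum>S\<in>Pow (I k). a S * b (I k - S))) \<le> ((\<Sum>S\<in>F. (a S)\<^sup>2) + (\<Sum>S\<in>F. (b S)\<^sup>2)) / 2"
proof (cases "K = {}")
  case False
  define N where "N f k = (\<Sum>S\<in>Pow (I k) - {{}}. (f S)\<^sup>2)" for f :: "'a set \<Rightarrow> real" and k
  have amgm: "x * y \<le> (x\<^sup>2 + y\<^sup>2) / 2" for x y :: real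
    using sum_squares_bound[of x y] by simp
  \<comment> \<open>Since the \<open>I k\<close> are disjoint, the empty set is the only set that
    belongs to several of the power sets.\<close>
  have total: "(\<Sum>S\<in>F. (f S)\<^sup>2) = (f {})\<^sup>2 + (\<Sum>k\<in>K. N f k)" for f :: "'a set \<Rightarrow> real"
  proof -
    have "(\<Sum>S\<in>F. (f S)\<^sup>2) = (f {})\<^sup>2 + (\<Sum>S\<in>F - {{}}. (f S)\<^sup>2)"
      using False K I(1) by (intro sum.remove) (auto simp: F_def)
    also have "F - {{}} = (\<Union>k\<in>K. Pow (I k) - {{}})" by (auto simp: F_def)
    also have "(\<Sum>S\<in>(\<Union>k\<in>K. Pow (I k) - {{}}). (f S)\<^sup>2) = (\<Sum>k\<in>K. N f k)"
      unfolding N_def using K I disj by (intro sum.UNION_disjoint) (simp_all, blast)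
    finally show ?thesis .
  qed
  have le: "c k * (\<Sum>S\<in>Pow (I k). a S * b (I k - S)) \<le>
      ((c k)\<^sup>2 * ((a {})\<^sup>2 + (b {})\<^sup>2) + N a k + N b k) / 2" if k: "k \<in> K" for k
  proof -
    \<comment> \<open>The proper nonempty subsets of \<open>I k\<close>; complementation in
      \<open>I k\<close> permutes them.\<close>
    define M where "M = Pow (I k) - {{}} - {I k}"
    have M: "finite M" using I(1)[OF k] by (simp add: M_def)
    have split: "(\<Sum>S\<in>Pow (I k) - {{}}. f S) = f (I k) + (\<Sum>S\<in>M. f S)" for f :: "'a set \<Rightarrow> real"
      unfolding M_def using I[OF k] by (intro sum.remove) auto
    have split0: "(\<Sum>S\<in>Pow (I k). f S) = f {} + (\<Sum>S\<in>Pow (I k) - {{}}. f S)" for f :: "'a set \<Rightarrow> real"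
      using I[OF k] by (intro sum.remove) auto
    \<comment> \<open>In the two extreme terms the factor \<open>c k\<close> is kept with the shared
      coefficient \<open>a {}\<close> or \<open>b {}\<close>, so that after squaring it can be
      summed over \<open>k\<close>; in the other terms it is bounded by 1.\<close>
    have "c k * (\<Sum>S\<in>Pow (I k). a S * b (I k - S)) =
        (c k * a {}) * b (I k) + a (I k) * (c k * b {}) + (\<Sum>S\<in>M. c k * (a S * b (I k - S)))"
      unfolding split0 split by (simp add: algebra_simps sum_distrib_left)
    also have "\<dots> \<le> ((c k * a {})\<^sup>2 + (b (I k))\<^sup>2) / 2 + ((a (I k))\<^sup>2 + (c k * b {})\<^sup>2) / 2
        + (\<Sum>S\<in>M. ((a S)\<^sup>2 + (b (I k - S))\<^sup>2) / 2)"
    proof (intro add_mono amgm sum_mono)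
      fix S
      have "c k * (a S * b (I k - S)) \<le> 1 * (a S * b (I k - S))"
        using c(1,2)[OF k] ab by (intro mult_right_mono) auto
      also have "\<dots> \<le> ((a S)\<^sup>2 + (b (I k - S))\<^sup>2) / 2" using amgm by simp
      finally show "c k * (a S * b (I k - S)) \<le> ((a S)\<^sup>2 + (b (I k - S))\<^sup>2) / 2" .
    qed
    also have "(\<Sum>S\<in>M. ((a S)\<^sup>2 + (b (I k - S))\<^sup>2) / 2) = ((\<Sum>S\<in>M. (a S)\<^sup>2) + (\<Sum>S\<in>M. (b S)\<^sup>2)) / 2"
    proof -
      have "(\<Sum>S\<in>M. (b (I k - S))\<^sup>2) = (\<Sum>S\<in>M. (b S)\<^sup>2)"
        by (rule sum.reindex_bij_witness[where i = "\<lambda>S. I k - S" and j = "\<lambda>S. I k - S"])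
          (auto simp: M_def double_diff)
      then show ?thesis by (simp add: sum.distrib flip: sum_divide_distrib)
    qed
    finally show ?thesis
      unfolding N_def split by (simp add: power_mult_distrib algebra_simps add_divide_distrib)
  qed
  have "(\<Sum>k\<in>K. c k * (\<Sum>S\<in>Pow (I k). a S * b (I k - S))) \<le>
      (\<Sum>k\<in>K. ((c k)\<^sup>2 * ((a {})\<^sup>2 + (b {})\<^sup>2) + N a k + N b k) / 2)"
    by (intro sum_mono le)
  also have "\<dots> = ((\<Sum>k\<in>K. (c k)\<^sup>2) * ((a {})\<^sup>2 + (b {})\<^sup>2) + (\<Sum>k\<in>K. N a k) + (\<Sum>k\<in>K. N b k)) / 2"
    by (simp add: sum.distrib sum_distrib_right flip: sum_divide_distrib)
  also have "\<dots> \<le> (1 * ((a {})\<^sup>2 + (b {})\<^sup>2) + (\<Sum>k\<in>K. N a k) + (\<Sum>k\<in>K. N b k)) / 2"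
    using c(3) by (intro divide_right_mono add_mono mult_right_mono) auto
  also have "\<dots> = ((\<Sum>S\<in>F. (a S)\<^sup>2) + (\<Sum>S\<in>F. (b S)\<^sup>2)) / 2"
    unfolding total by simp
  finally show ?thesis .
qed (simp add: F_def)

lemma norm_L2_inner_symbol_partial_sum_le:
  assumes f: "f \<in> analytic_polynomials" and g: "g \<in> H2"
  shows "norm (L2_inner (\<lambda>z. f z * g z) (symbol_partial_sum n)) \<le> ((L2_norm f)\<^sup>2 + (L2_norm g)\<^sup>2) / 2"
proof -
  have fL: "f \<in> Lp 2" and gL: "g \<in> Lp 2"
    using f g by (auto intro: H2_L2 analytic_polynomial_H2)
  let ?a = "\<lambda>S. norm (L2_inner f (pair_prod S))" and ?b = "\<lambda>S. norm (L2_inner g (pair_prod S))"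
  let ?F = "\<Union>k\<in>{1..n}. Pow (block k)"
  have F: "finite ?F" "\<And>S. S \<in> ?F \<Longrightarrow> finite S"
    by (auto intro: finite_subset)
  have "L2_inner (\<lambda>z. f z * g z) (symbol_partial_sum n) =
      (\<Sum>k\<in>{1..n}. L2_inner (\<lambda>z. f z * g z) (\<lambda>z. complex_of_real (weight k) * pair_prod (block k) z))"
    unfolding symbol_partial_sum_fun
    by (intro L2_inner_sum_right L2_cmult pair_prod_L2 finite_block analytic_polynomial_mult_L2 f gL)
  also have "\<dots> = (\<Sum>k\<in>{1..n}. complex_of_real (weight k) *
      (\<Sum>S\<in>Pow (block k). L2_inner f (pair_prod S) * L2_inner g (pair_prod (block k - S))))"
    unfolding L2_inner_cmult_right by (simp add: L2_inner_mult_pair_prod[OF f g])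
  also have "norm \<dots> \<le> (\<Sum>k\<in>{1..n}. weight k * (\<Sum>S\<in>Pow (block k). ?a S * ?b (block k - S)))"
    by (intro order_trans[OF norm_sum] sum_mono)
      (auto simp: norm_mult weight_nonneg intro!: mult_left_mono order_trans[OF norm_sum])
  also have "\<dots> \<le> ((\<Sum>S\<in>?F. (?a S)\<^sup>2) + (\<Sum>S\<in>?F. (?b S)\<^sup>2)) / 2"
  proof (rule sum_disjoint_blocks_le)
    fix k assume "k \<in> {1..n}"
    then show "block k \<noteq> {}" using card_block[of k] by auto
  qed (use weight_nonneg weight_le_1 sum_weight_sq_le_1 block_disjoint in auto)
  also have "\<dots> \<le> ((L2_norm f)\<^sup>2 + (L2_norm g)\<^sup>2) / 2"
    using F by (intro divide_right_mono add_mono L2_Bessel) (auto simp: L2_inner_pair_prod pair_prod_L2 fL gL)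
  finally show ?thesis .
qed

text \<open>The form is tested on the conjugate \<open>g\<close> of the image \<open>G\<close> of
  \<open>f\<close>: since \<open>G\<close> is a projection of \<open>h\<close>, the squared norm of
  \<open>G\<close> is the inner product of \<open>h\<close> with \<open>G\<close>, which is that of
  \<open>f g\<close> with \<phi>.\<close>

lemma L2_norm_hankel_symbol_le:
  assumes \<phi>: "is_symbol \<phi>" and f: "f \<in> analytic_polynomials" "L2_norm f = 1"
  shows "L2_norm (hankel \<phi> f) \<le> 1"
proof -
  define h where "h z = cnj (\<phi> z) * f z" for z
  define G where "G = hankel \<phi> f"
  let ?g = "\<lambda>z. cnj (G z)"
  have \<phi>L: "\<phi> \<in> Lp 2" and lim: "(\<lambda>n. L2_norm (\<lambda>z. \<phi> z - symbol_partial_sum n z)) \<longlonglongrightarrow> 0"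
    using \<phi> by (auto simp: is_symbol_def H2_L2)
  have hL: "h \<in> Lp 2"
    using analytic_polynomial_mult_L2[OF f(1) L2_cnj[OF \<phi>L]] by (simp add: h_def[abs_def] mult.commute)
  have G: "G = orth_proj conj_H2 h" by (simp add: G_def hankel_def h_def[abs_def])
  have Gc: "G \<in> conj_H2" and orth: "L2_inner (\<lambda>z. h z - G z) G = 0"
    using orth_proj_mem[OF L2_closed_subspace_conj_H2 hL] orth_proj_orthogonal[OF L2_closed_subspace_conj_H2 hL]
    unfolding G by auto
  have GL: "G \<in> Lp 2" and g: "?g \<in> H2" using Gc by (auto simp: conj_H2_L2 conj_H2_iff)
  have fg: "(\<lambda>z. f z * ?g z) \<in> Lp 2"
    by (rule analytic_polynomial_mult_L2[OF f(1) H2_L2[OF g]])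
  have "L2_inner h G = L2_inner (\<lambda>z. f z * ?g z) \<phi>"
    by (simp add: L2_inner_def h_def mult_ac)
  then have inner: "L2_inner (\<lambda>z. f z * ?g z) \<phi> = of_real ((L2_norm G)\<^sup>2)"
    using orth L2_inner_self[of G] by (simp add: L2_inner_diff_left hL GL del: of_real_power)
  have "(\<lambda>n. L2_inner (symbol_partial_sum n) (\<lambda>z. f z * ?g z)) \<longlonglongrightarrow> L2_inner \<phi> (\<lambda>z. f z * ?g z)"
    by (rule tendsto_L2_inner_left[OF symbol_partial_sum_L2 \<phi>L fg lim])
  then have "(\<lambda>n. norm (L2_inner (symbol_partial_sum n) (\<lambda>z. f z * ?g z))) \<longlonglongrightarrow> norm (L2_inner \<phi> (\<lambda>z. f z * ?g z))"
    by (rule tendsto_norm)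
  then have "norm (L2_inner \<phi> (\<lambda>z. f z * ?g z)) \<le> ((L2_norm f)\<^sup>2 + (L2_norm ?g)\<^sup>2) / 2"
  proof (rule LIMSEQ_le_const2, intro exI allI impI)
    fix n
    show "norm (L2_inner (symbol_partial_sum n) (\<lambda>z. f z * ?g z)) \<le> ((L2_norm f)\<^sup>2 + (L2_norm ?g)\<^sup>2) / 2"
      using norm_L2_inner_symbol_partial_sum_le[OF f(1) g, of n]
      by (subst L2_inner_commute) simp
  qed
  moreover have "norm (L2_inner \<phi> (\<lambda>z. f z * ?g z)) = (L2_norm G)\<^sup>2"
    by (subst L2_inner_commute) (simp add: inner del: of_real_power)
  \<comment> \<open>With x the squared norm of \<open>G\<close> and \<open>L2_norm f = 1\<close>,
    the bound reads x \<le> (1 + x) / 2, which gives x \<le> 1 without normalizing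
    \<open>G\<close>.\<close>
  ultimately have "(L2_norm G)\<^sup>2 \<le> 1\<^sup>2"
    using f(2) by (simp add: L2_norm_cnj)
  then show ?thesis unfolding G_def by (rule power2_le_imp_le) simp
qed

text \<open>The conjugate of \<phi> already lies in \<open>conj_H2\<close>, so the residual of its
  projection lies there too and is orthogonal to itself.\<close>

lemma L2_norm_le_hankel_1:
  assumes \<phi>: "\<phi> \<in> H2"
  shows "L2_norm \<phi> \<le> L2_norm (hankel \<phi> (\<lambda>_. 1))"
proof -
  let ?h = "\<lambda>z. cnj (\<phi> z)"
  define G where "G = hankel \<phi> (\<lambda>_. 1)"
  have h: "?h \<in> conj_H2" using \<phi> by (simp add: conj_H2_iff)
  have G: "G = orth_proj conj_H2 ?h" by (simp add: G_def hankel_def)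
  have Gc: "G \<in> conj_H2"
    unfolding G by (rule orth_proj_mem[OF L2_closed_subspace_conj_H2 conj_H2_L2[OF h]])
  have "(\<lambda>z. cnj (?h z) + (-1) * cnj (G z)) \<in> H2"
    using h Gc unfolding conj_H2_iff by (rule H2_add[OF _ H2_cmult])
  then have "(\<lambda>z. ?h z - G z) \<in> conj_H2" by (simp add: conj_H2_iff)
  then have "L2_inner (\<lambda>z. ?h z - G z) (\<lambda>z. ?h z - G z) = 0"
    unfolding G by (rule orth_proj_orthogonal[OF L2_closed_subspace_conj_H2 conj_H2_L2[OF h]])
  then have "L2_norm (\<lambda>z. ?h z - G z) = 0" by (simp add: L2_inner_self)
  moreover have "L2_norm (\<lambda>z. (?h z - G z) + G z) \<le> L2_norm (\<lambda>z. ?h z - G z) + L2_norm G"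
    using conj_H2_L2 h Gc by (intro L2_norm_triangle) auto
  ultimately show ?thesis by (simp add: L2_norm_cnj G_def)
qed

lemma hankel_norm_symbol:
  assumes "is_symbol \<phi>"
  shows "hankel_norm \<phi> = 1"
proof (rule antisym)
  show "hankel_norm \<phi> \<le> 1"
    unfolding hankel_norm_def using L2_norm_hankel_symbol_le[OF assms] by (auto intro!: SUP_least)
  have one: "(\<lambda>_. 1) \<in> analytic_polynomials"
    unfolding analytic_polynomials_def
    by (intro CollectI exI[of _ "{0}"] exI[of _ "\<lambda>_. 1"]) (auto simp: nonneg_exponent_def)
  have "1 \<le> ennreal (L2_norm (hankel \<phi> (\<lambda>_. 1)))"
    using L2_norm_le_hankel_1[of \<phi>] assms by (simp add: L2_norm_symbol is_symbol_def)
  also have "\<dots> \<le> hankel_norm \<phi>"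
    unfolding hankel_norm_def by (rule SUP_upper) (simp add: one L2_norm_const)
  finally show "1 \<le> hankel_norm \<phi>" .
qed

section \<open>Sub-quadratic moments of the products\<close>

text \<open>Strict concavity: the right side is the tangent of x^s at 1. With u the mean of x and 1
  with weights s and 1 - s, the bound ln t \<le> t - 1 is applied at x / u and 1 / u; the weighted
  right sides cancel, and the second bound is strict because u differs from 1.\<close>

lemma powr_less_tangent:
  fixes x s :: real
  assumes "0 \<le> x" "x \<noteq> 1" "0 < s" "s < 1"
  shows "x powr s < 1 + s * (x - 1)"
proof (cases "x = 0")
  case False
  define u where "u = 1 + s * (x - 1)"
  have u: "u = s * x + (1 - s)" by (simp add: u_def algebra_simps)
  have x: "x > 0" and "u > 0" using assms False unfolding u by (auto intro: add_pos_pos)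
  have "u \<noteq> 1" using assms by (simp add: u_def)
  have "s * ln (x / u) \<le> s * (x / u - 1)"
    using x \<open>u > 0\<close> assms ln_le_minus_one[of "x / u"] by (intro mult_left_mono) auto
  moreover have "ln (1 / u) < 1 / u - 1"
    using \<open>u > 0\<close> \<open>u \<noteq> 1\<close> ln_le_minus_one[of "1 / u"] ln_eq_minus_one[of "1 / u"] by (auto simp: less_le)
  then have "(1 - s) * ln (1 / u) < (1 - s) * (1 / u - 1)"
    using assms by (intro mult_strict_left_mono) auto
  moreover have "s * (x / u - 1) + (1 - s) * (1 / u - 1) = 0"
    using \<open>u > 0\<close> u by (simp add: field_simps)
  ultimately have "s * ln (x / u) + (1 - s) * ln (1 / u) < 0" by linarith
  then have "s * ln x < ln u"
    using x \<open>u > 0\<close> by (simp add: ln_div algebra_simps)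
  then have "x powr s < exp (ln u)"
    using x by (simp add: powr_def)
  then show ?thesis using \<open>u > 0\<close> by (simp add: u_def)
qed (use assms in simp)

lemma pair_mean_measurable [measurable]: "pair_mean j \<in> borel_measurable torus_haar"
  unfolding pair_mean_def[abs_def] by measurable

lemma pair_prod_singleton: "pair_prod {j} = pair_mean j"
  by (simp add: pair_prod_def fun_eq_iff)

lemma norm_pair_mean_le:
  assumes "z \<in> space torus_haar"
  shows "norm (pair_mean j z) \<le> 2"
proof -
  have "norm (z (2 * j) + z (2 * j + 1)) \<le> 2"
    using norm_triangle_ineq[of "z (2 * j)" "z (2 * j + 1)"] assms by simp
  also have "2 \<le> 2 * sqrt 2" by simp
  finally show ?thesis
    unfolding pair_mean_def by (simp add: norm_divide divide_le_eq)
qed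

lemma integrable_norm_pair_mean_powr:
  assumes "0 \<le> q"
  shows "integrable torus_haar (\<lambda>z. norm (pair_mean j z) powr q)"
  by (rule torus.integrable_const_bound[of _ "2 powr q"])
    (use assms in \<open>auto intro!: AE_I2 powr_mono2 norm_pair_mean_le\<close>)

lemma integral_norm_pair_mean_sq: "(LINT z|torus_haar. (norm (pair_mean j z))\<^sup>2) = 1"
  using L2_norm_pair_prod[of "{j}"] by (simp add: pair_prod_singleton flip: L2_norm_sq)

text \<open>The squared modulus of a pair mean has the nonzero Fourier coefficient \<open>1/2\<close> at
  \<open>z (2 j) cnj (z (2 j + 1))\<close>.\<close>

lemma norm_pair_mean_not_AE_1: "\<not> (AE z in torus_haar. (norm (pair_mean j z))\<^sup>2 = 1)"
proof
  assume ae: "AE z in torus_haar. (norm (pair_mean j z))\<^sup>2 = 1"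
  let ?a = "Poly_Mapping.single (2 * j) (1::int)" and ?b = "Poly_Mapping.single (2 * j + 1) (1::int)"
  let ?f = "\<lambda>z. complex_of_real ((norm (pair_mean j z))\<^sup>2 - 1)"
  have single: "character (Poly_Mapping.single i 1) z = z i" for i z
    by (simp add: character_def)
  have f: "?f z = (1/2) * character (?a - ?b) z + (1/2) * character (?b - ?a) z"
    if z: "z \<in> space torus_haar" for z
  proof -
    have sq: "z i * cnj (z i) = 1" for i
      using norm_torus[OF z, of i] by (simp add: complex_norm_square[symmetric])
    have "?f z = pair_mean j z * cnj (pair_mean j z) - 1"
      by (simp add: complex_norm_square[symmetric])
    also have "\<dots> = (z (2 * j) * cnj (z (2 * j)) + z (2 * j + 1) * cnj (z (2 * j + 1))
        + z (2 * j) * cnj (z (2 * j + 1)) + z (2 * j + 1) * cnj (z (2 * j))) / 2 - 1"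
      by (simp add: pair_mean_def field_simps flip: of_real_mult)
    finally show ?thesis
      unfolding sq character_diff[OF z] single by (simp add: field_simps)
  qed
  have ne: "?b - ?a \<noteq> ?a - ?b"
  proof
    assume "?b - ?a = ?a - ?b"
    then have "Poly_Mapping.lookup (?b - ?a) (2 * j) = Poly_Mapping.lookup (?a - ?b) (2 * j)" by simp
    then show False by (simp add: lookup_minus lookup_single)
  qed
  have "L2_inner ?f (character (?a - ?b)) =
      L2_inner (\<lambda>z. (1/2) * character (?a - ?b) z + (1/2) * character (?b - ?a) z) (character (?a - ?b))"
    by (rule L2_inner_cong) (simp_all only: f)
  also have "\<dots> = L2_inner (\<lambda>z. (1/2) * character (?a - ?b) z) (character (?a - ?b)) +
      L2_inner (\<lambda>z. (1/2) * character (?b - ?a) z) (character (?a - ?b))"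
    by (intro L2_inner_add_left L2_cmult character_L2)
  also have "\<dots> = 1 / 2"
    unfolding L2_inner_cmult_left L2_inner_character using ne by simp
  finally have "L2_inner ?f (character (?a - ?b)) = 1 / 2" .
  moreover have "L2_inner ?f (character (?a - ?b)) = (LINT z|torus_haar. 0)"
    unfolding L2_inner_def
  proof (rule integral_cong_AE)
    show "AE z in torus_haar. ?f z * cnj (character (?a - ?b) z) = 0"
      using ae by eventually_elim simp
  qed measurable
  ultimately show False by simp
qed

text \<open>The squared modulus has mean 1, so the tangent bound with s = q / 2 integrates to at
  most 1. Equality would force the nonnegative gap \<open>h\<close> to vanish almost everywhere,
  hence the modulus to be 1 almost everywhere.\<close>

lemma integral_norm_pair_mean_powr_less_1:
  assumes "0 < q" "q < 2"
  shows "(LINT z|torus_haar. norm (pair_mean j z) powr q) < 1"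
proof (rule ccontr)
  assume ge: "\<not> (LINT z|torus_haar. norm (pair_mean j z) powr q) < 1"
  define h where "h z = 1 + (q / 2) * ((norm (pair_mean j z))\<^sup>2 - 1) - norm (pair_mean j z) powr q" for z
  have powr: "norm (pair_mean j z) powr q = ((norm (pair_mean j z))\<^sup>2) powr (q / 2)" for z
    by (cases "norm (pair_mean j z) = 0") (simp_all add: powr_powr flip: powr_numeral)
  have pos: "h z > 0" if "(norm (pair_mean j z))\<^sup>2 \<noteq> 1" for z
    using powr_less_tangent[of "(norm (pair_mean j z))\<^sup>2" "q / 2"] assms that
    by (simp add: h_def powr)
  have zero: "h z = 0" if "(norm (pair_mean j z))\<^sup>2 = 1" for z
    using that by (simp add: h_def powr)
  have nonneg: "0 \<le> h z" for z
    using pos[of z] zero[of z] by (cases "(norm (pair_mean j z))\<^sup>2 = 1") auto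
  note int = L2_integrable_norm_sq[OF pair_prod_L2[of "{j}"], unfolded pair_prod_singleton, simplified]
    integrable_norm_pair_mean_powr[of q j]
  have "integrable torus_haar h"
    unfolding h_def[abs_def] using int assms by auto
  moreover have "(LINT z|torus_haar. h z) = 1 - (LINT z|torus_haar. norm (pair_mean j z) powr q)"
    unfolding h_def using int assms
    by (simp add: integral_norm_pair_mean_sq torus.prob_space)
  then have "(LINT z|torus_haar. h z) = 0"
    using ge Bochner_Integration.integral_nonneg[of torus_haar h] nonneg by simp
  ultimately have "AE z in torus_haar. h z = 0"
    using nonneg by (simp add: integral_nonneg_eq_0_iff_AE)
  then have "AE z in torus_haar. (norm (pair_mean j z))\<^sup>2 = 1"
    by eventually_elim (metis pos less_irrefl)
  then show False using norm_pair_mean_not_AE_1 by blast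
qed

lemma distr_torus_shift: "distr torus_haar torus_haar (\<lambda>z n. z (n + m)) = torus_haar"
  using distr_PiM_reindex[of UNIV "\<lambda>_. circle_haar" "\<lambda>n. n + m" UNIV] prob_space_circle_haar
  by (simp add: torus_haar_def restrict_UNIV inj_on_def)

text \<open>Pair \<open>j\<close> is pair 0 seen after a shift by \<open>2 * j\<close> coordinates,
  and the shift preserves the product measure.\<close>

lemma integral_norm_pair_mean_powr_eq:
  "(LINT z|torus_haar. norm (pair_mean j z) powr q) = (LINT z|torus_haar. norm (pair_mean 0 z) powr q)"
proof -
  have shift: "(\<lambda>z n. z (n + m)) \<in> torus_haar \<rightarrow>\<^sub>M torus_haar" for m :: nat
    unfolding torus_haar_def by (rule measurable_PiM_single') (auto simp: space_PiM)
  have "(LINT z|torus_haar. norm (pair_mean 0 z) powr q) =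
      (LINT z|distr torus_haar torus_haar (\<lambda>z n. z (n + 2 * j)). norm (pair_mean 0 z) powr q)"
    by (simp only: distr_torus_shift)
  also have "\<dots> = (LINT z|torus_haar. norm (pair_mean 0 (\<lambda>n. z (n + 2 * j))) powr q)"
    by (rule integral_distr[OF shift]) measurable
  finally show ?thesis by (simp add: pair_mean_def)
qed

text \<open>The pair means are functions of disjoint pairs of independent coordinates.\<close>

lemma indep_pair_means:
  "torus.indep_vars (\<lambda>_. borel) (\<lambda>j z. norm (pair_mean j z) powr q) I"
proof -
  let ?K = "\<lambda>j. {2 * j, 2 * j + 1}"
  let ?Y = "\<lambda>j x. norm ((x (2 * j) + x (2 * j + 1)) / complex_of_real (sqrt 2)) powr q"
  have "disjoint_family_on ?K I"
    by (auto simp: disjoint_family_on_def)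
  then have "torus.indep_vars (\<lambda>j. PiM (?K j) (\<lambda>_. circle_haar)) (\<lambda>j z. restrict (\<lambda>i. z i) (?K j)) I"
    by (intro torus.indep_vars_restrict[OF indep_torus_components]) auto
  then have "torus.indep_vars (\<lambda>_. borel) (\<lambda>j z. ?Y j (restrict (\<lambda>i. z i) (?K j))) I"
  proof (rule torus.indep_vars_compose2)
    fix j
    have [measurable]: "(\<lambda>x. x i) \<in> borel_measurable (PiM (?K j) (\<lambda>_. circle_haar))" if "i \<in> ?K j" for i
      using measurable_compose[OF measurable_component_singleton[OF that, of "\<lambda>_. circle_haar"]
          id_measurable_circle_haar] .
    show "?Y j \<in> borel_measurable (PiM (?K j) (\<lambda>_. circle_haar))"
      by measurable
  qed
  then show ?thesis
    by (simp add: pair_mean_def)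
qed

lemma
  assumes "finite I" "0 \<le> q"
  shows integrable_norm_pair_prod_powr: "integrable torus_haar (\<lambda>z. norm (pair_prod I z) powr q)"
    and integral_norm_pair_prod_powr: "(LINT z|torus_haar. norm (pair_prod I z) powr q) =
      (LINT z|torus_haar. norm (pair_mean 0 z) powr q) ^ card I"
proof -
  have eq: "norm (pair_prod I z) powr q = (\<Prod>j\<in>I. norm (pair_mean j z) powr q)" for z
    by (simp add: pair_prod_def prod_norm[symmetric] prod_powr_distrib)
  show "integrable torus_haar (\<lambda>z. norm (pair_prod I z) powr q)"
    unfolding eq using assms
    by (intro torus.indep_vars_integrable indep_pair_means integrable_norm_pair_mean_powr)
  have "(LINT z|torus_haar. norm (pair_prod I z) powr q) =
      (\<Prod>j\<in>I. LINT z|torus_haar. norm (pair_mean j z) powr q)"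
    unfolding eq using assms
    by (intro torus.indep_vars_lebesgue_integral indep_pair_means integrable_norm_pair_mean_powr)
  also have "\<dots> = (\<Prod>j\<in>I. LINT z|torus_haar. norm (pair_mean 0 z) powr q)"
    by (intro prod.cong refl integral_norm_pair_mean_powr_eq)
  finally show "(LINT z|torus_haar. norm (pair_prod I z) powr q) =
      (LINT z|torus_haar. norm (pair_mean 0 z) powr q) ^ card I"
    by simp
qed

section \<open>The symbol is not the projection of a function in a smaller Lebesgue space\<close>

text \<open>Reduces every \<open>p\<close> to a finite exponent, so that a conjugate exponent above
  1 is available. An essentially bounded function has all moments on a probability space; 3 is one
  choice above 2.\<close>

lemma Lp_gt_2_integrable_powr:
  assumes "\<psi> \<in> Lp p" "2 < p"
  obtains r where "2 < r" "integrable torus_haar (\<lambda>z. norm (\<psi> z) powr r)"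
proof (cases "p = \<infinity>")
  case True
  have [measurable]: "\<psi> \<in> borel_measurable torus_haar"
    and e: "esssup torus_haar (\<lambda>z. ereal (norm (\<psi> z))) < \<infinity>"
    using assms(1) True by (auto simp: Lp_def)
  obtain B where B: "esssup torus_haar (\<lambda>z. ereal (norm (\<psi> z))) \<le> ereal B"
    using e by (cases "esssup torus_haar (\<lambda>z. ereal (norm (\<psi> z)))") auto
  have "AE z in torus_haar. norm (norm (\<psi> z) powr 3) \<le> B powr 3"
    using esssup_AE[of "\<lambda>z. ereal (norm (\<psi> z))" torus_haar]
  proof eventually_elim
    case (elim z)
    then have "norm (\<psi> z) \<le> B" using B by (metis ereal_less_eq(3) order_trans)
    then show ?case by (simp add: powr_mono2 del: powr_numeral)
  qed
  then have "integrable torus_haar (\<lambda>z. norm (\<psi> z) powr 3)"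
    by (rule torus.integrable_const_bound) measurable
  then show ?thesis by (intro that[of 3]) auto
next
  case False
  then have "2 < enn2real p"
    using assms(2) by (cases p) auto
  then show ?thesis
    using assms(1) False by (intro that[of "enn2real p"]) (auto simp: Lp_def)
qed

text \<open>Places \<psi> in the domain where the specification of \<open>orth_proj\<close> is known
  to hold.\<close>

lemma L2_if_integrable_powr:
  assumes "\<psi> \<in> borel_measurable torus_haar" "2 < r" "integrable torus_haar (\<lambda>z. norm (\<psi> z) powr r)"
  shows "\<psi> \<in> Lp 2"
proof -
  note [measurable] = assms(1)
  have le: "x\<^sup>2 \<le> 1 + x powr r" if "0 \<le> x" for x :: real
  proof (cases "x \<le> 1")
    case True
    then have "x\<^sup>2 \<le> 1" using that by (simp add: power_le_one)
    then show ?thesis by (simp add: add_increasing2)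
  next
    case False
    then have "x powr 2 \<le> x powr r" using assms(2) by (intro powr_mono) auto
    then show ?thesis using False by simp
  qed
  have "integrable torus_haar (\<lambda>z. (norm (\<psi> z))\<^sup>2)"
  proof (rule Bochner_Integration.integrable_bound)
    show "integrable torus_haar (\<lambda>z. 1 + norm (\<psi> z) powr r)" using assms(3) by simp
    show "AE z in torus_haar. norm ((norm (\<psi> z))\<^sup>2) \<le> norm (1 + norm (\<psi> z) powr r)"
      using le by (intro AE_I2) simp
  qed measurable
  then show ?thesis using assms(1) by (simp add: L2_iff)
qed

lemma symbol_not_projection:
  assumes \<phi>: "is_symbol \<phi>" and \<psi>: "\<psi> \<in> borel_measurable torus_haar" and r: "2 < r"
    and int: "integrable torus_haar (\<lambda>z. norm (\<psi> z) powr r)"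
  shows "\<not> (AE z in torus_haar. orth_proj H2 \<psi> z = \<phi> z)"
proof
  assume ae: "AE z in torus_haar. orth_proj H2 \<psi> z = \<phi> z"
  have \<psi>L: "\<psi> \<in> Lp 2" by (rule L2_if_integrable_powr[OF \<psi> r int])
  have \<phi>L: "\<phi> \<in> Lp 2" using \<phi> by (auto simp: is_symbol_def H2_L2)
  note proj = orth_proj_mem[OF L2_closed_subspace_H2 \<psi>L] orth_proj_orthogonal[OF L2_closed_subspace_H2 \<psi>L]
  have [measurable]: "orth_proj H2 \<psi> \<in> borel_measurable torus_haar" "\<phi> \<in> borel_measurable torus_haar"
    "\<And>k. pair_prod (block k) \<in> borel_measurable torus_haar" "\<psi> \<in> borel_measurable torus_haar"
    using \<phi>L \<psi> L2_measurable[OF H2_L2[OF proj(1)]] L2_measurable[OF pair_prod_L2[OF finite_block]]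
    by (auto simp: L2_iff)
  define q where "q = r / (r - 1)"
  have q: "1 < q" "q < 2" "1 / r + 1 / q = 1"
    using r by (auto simp: q_def field_simps)
  define \<rho> where "\<rho> = (LINT z|torus_haar. norm (pair_mean 0 z) powr q)"
  have \<rho>: "0 \<le> \<rho>" "\<rho> < 1"
    using integral_norm_pair_mean_powr_less_1[of q 0] q by (auto simp: \<rho>_def)
  define A where "A = (LINT z|torus_haar. norm (\<psi> z) powr r)"
  have A: "0 \<le> A" by (simp add: A_def)
  define C where "C = sqrt 6 / pi"
  \<comment> \<open>Young's inequality with the weights k^(-2) on \<psi> and k^2 on the block
    product replaces Hoelder's. After multiplication by \<open>k\<close> the left side is constant,
    and both terms on the right tend to 0.\<close>
  have bound: "C \<le> A / real k + real k ^ 5 * ((1 + \<rho>) / 2) ^ k" if k: "k \<ge> 1" for k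
  proof -
    let ?e = "pair_prod (block k)" and ?k = "real k"
    have k1: "?k \<ge> 1" using k by simp
    \<comment> \<open>The block product lies in \<open>H2\<close>, so it does not see the difference
      between \<psi> and its projection.\<close>
    have "L2_inner \<psi> ?e = L2_inner (orth_proj H2 \<psi>) ?e"
      using proj(2)[OF pair_prod_H2[OF finite_block, of k]]
      by (simp add: L2_inner_diff_left \<psi>L H2_L2 proj(1) pair_prod_L2)
    also have "\<dots> = L2_inner \<phi> ?e"
      unfolding L2_inner_def using ae by (intro integral_cong_AE) (auto elim!: eventually_mono)
    finally have "weight k = norm (L2_inner \<psi> ?e)"
      using L2_inner_symbol_block[OF \<phi> k] by (simp add: weight_nonneg)
    also have "\<dots> \<le> (LINT z|torus_haar. norm (\<psi> z * cnj (?e z)))"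
      unfolding L2_inner_def by (rule integral_norm_bound)
    also have "\<dots> \<le> (LINT z|torus_haar. ?k powr (- 2 * r) * norm (\<psi> z) powr r + ?k powr (2 * q) * norm (?e z) powr q)"
    proof (rule integral_mono)
      show "integrable torus_haar (\<lambda>z. norm (\<psi> z * cnj (?e z)))"
        by (intro integrable_norm L2_integrable_inner \<psi>L pair_prod_L2 finite_block)
      show "integrable torus_haar (\<lambda>z. ?k powr (- 2 * r) * norm (\<psi> z) powr r + ?k powr (2 * q) * norm (?e z) powr q)"
        using int integrable_norm_pair_prod_powr[of "block k" q] q by simp
      fix z
      let ?x = "?k powr (-2) * norm (\<psi> z)" and ?y = "?k powr 2 * norm (?e z)"
      have "?k powr (-2) * ?k powr 2 = 1" using k1 by (simp add: powr_minus)
      then have "norm (\<psi> z * cnj (?e z)) = (?k powr (-2) * ?k powr 2) * (norm (\<psi> z) * norm (?e z))"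
        by (simp only: norm_mult complex_mod_cnj mult_1)
      also have "\<dots> = ?x * ?y" by simp
      also have "\<dots> \<le> ?x powr r / r + ?y powr q / q"
        using r q by (intro Youngs_inequality) auto
      also have "\<dots> \<le> ?x powr r / 1 + ?y powr q / 1"
        using r q by (intro add_mono divide_left_mono) auto
      finally show "norm (\<psi> z * cnj (?e z)) \<le>
          ?k powr (- 2 * r) * norm (\<psi> z) powr r + ?k powr (2 * q) * norm (?e z) powr q"
        by (simp add: powr_mult powr_powr del: powr_numeral)
    qed
    also have "\<dots> = ?k powr (- 2 * r) * A + ?k powr (2 * q) * \<rho> ^ k"
      using int integrable_norm_pair_prod_powr[of "block k" q] integral_norm_pair_prod_powr[of "block k" q] q
      by (simp add: A_def \<rho>_def card_block)
    \<comment> \<open>Here r > 1 and q < 2 give integer exponents, and \<rho> is raised to (1 +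
      \<rho>) / 2, which is still below 1 but strictly positive, as the asymptotic evaluation of the
      limit requires.\<close>
    also have "\<dots> \<le> ?k powr (- 2) * A + ?k powr 4 * ((1 + \<rho>) / 2) ^ k"
      using k1 A r q \<rho> by (intro add_mono mult_mono powr_mono power_mono) auto
    finally have "?k * weight k \<le> ?k * (?k powr (- 2) * A + ?k powr 4 * ((1 + \<rho>) / 2) ^ k)"
      using k1 by (intro mult_left_mono) auto
    moreover have "?k * weight k = C" using k1 by (simp add: C_def weight_def)
    moreover have "?k * (?k powr (- 2) * A + ?k powr 4 * s) = A / ?k + ?k ^ 5 * s" for s
    proof -
      have "?k powr (- 2) = 1 / (?k * ?k)" "?k powr 4 = ?k ^ 4"
        using k1 by (simp_all add: powr_minus power2_eq_square divide_inverse)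
      then show ?thesis
        using k1 by (simp add: distrib_left eval_nat_numeral)
    qed
    ultimately show ?thesis by simp
  qed
  have "(\<lambda>k. A / real k + real k ^ 5 * ((1 + \<rho>) / 2) ^ k) \<longlonglongrightarrow> 0"
  proof -
    define \<sigma> where "\<sigma> = (1 + \<rho>) / 2"
    have "0 < \<sigma>" "\<sigma> < 1" using \<rho> by (auto simp: \<sigma>_def)
    then have "(\<lambda>k. A / real k + real k ^ 5 * \<sigma> ^ k) \<longlonglongrightarrow> 0" by real_asymp
    then show ?thesis by (simp add: \<sigma>_def)
  qed
  then have "C \<le> 0"
    by (rule LIMSEQ_le_const) (use bound in blast)
  moreover have "C > 0" by (simp add: C_def)
  ultimately show False by simp
qed

text \<open>An L2 limit fixes the symbol only up to a null set, hence the quantification over all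
  representatives; the existence clause keeps it from being vacuous.\<close>

theorem theorem3:
  shows "(\<exists>\<phi>. is_symbol \<phi>) \<and>
    (\<forall>\<phi>. is_symbol \<phi> \<longrightarrow>
      hankel_norm \<phi> = 1 \<and> L2_norm \<phi> = 1 \<and>
      (\<forall>p::ennreal. 2 < p \<and> p \<le> \<infinity> \<longrightarrow>
        \<not> (\<exists>\<psi>\<in>Lp p. AE z in torus_haar. orth_proj H2 \<psi> z = \<phi> z)))"
proof (intro conjI allI impI is_symbol_exists)
  fix \<phi> assume \<phi>: "is_symbol \<phi>"
  show "hankel_norm \<phi> = 1" "L2_norm \<phi> = 1"
    using \<phi> by (simp_all add: hankel_norm_symbol L2_norm_symbol)
  fix p :: ennreal assume p: "2 < p \<and> p \<le> \<infinity>"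
  show "\<not> (\<exists>\<psi>\<in>Lp p. AE z in torus_haar. orth_proj H2 \<psi> z = \<phi> z)"
  proof (rule notI, elim bexE)
    fix \<psi> assume \<psi>: "\<psi> \<in> Lp p" and ae: "AE z in torus_haar. orth_proj H2 \<psi> z = \<phi> z"
    obtain r where "2 < r" "integrable torus_haar (\<lambda>z. norm (\<psi> z) powr r)"
      using Lp_gt_2_integrable_powr[OF \<psi>] p by blast
    moreover have "\<psi> \<in> borel_measurable torus_haar" using \<psi> by (simp add: Lp_def)
    ultimately show False using symbol_not_projection[OF \<phi>] ae by blast
  qed
qed

end
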